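(* Let $\gamma:I\to\mathbb{G}$ be a unit speed Frenet curve with $\tau-\tau_{\mathbb G}\neq0$ on $I$, and let $\gamma^*$ be its conjugate mate. Then $\gamma$ is a general helix if and only if $\gamma^*$ is a general helix.
   Context: Let $\mathbb{G}$ be a three-dimensional Lie group with a bi-invariant Riemannian metric $\langle\cdot,\cdot\rangle$, with (oriented) Lie algebra $\mathfrak g$ and Levi-Civita connection $\nabla$; $I\subset\mathbb R$ is an interval and curves are smooth. Vector fields along a curve in $\mathbb G$ are identified with $\mathfrak g$-valued maps by left translation: fixing an orthonormal basis $X_1,X_2,X_3$ of left-invariant fields, write $U=\sum u_iX_i$, and set $U'=\sum u_i'X_i$, $[U,V]=\sum u_iv_j[X_i,X_j]$; then $\nabla_TU=U'+\frac12[T,U]$ with $T=\gamma'$. Vector fields along different curves with the same parameter interval are compared as $\mathfrak g$-valued maps. A unit speed curve $\gamma$ has Frenet-Serret apparatus $\{T,N,B,\kappa,\tau\}$ if $\kappa=\|\nabla_TT\|>0$, $(T,N,B)$ is a positively oriented orthonormal frame, and $\nabla_TT=\kappa N$, $\nabla_TN=-\kappa T+\tau B$, $\nabla_TB=-\tau N$. It is a Frenet curve if moreover $\tau\neq0$. The Lie group torsion is $\tau_{\mathbb G}=\frac12\langle[T,N],B\rangle$; the harmonic curvature is $H=(\tau-\tau_{\mathbb G})/\kappa$. The same notions apply to any unit speed curve with a Frenet-Serret apparatus. A unit speed curve $\gamma^*:I\to\mathbb G$ with Frenet-Serret apparatus $\{T^*,N^*,B^*,\kappa^*,\tau^*\}$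 is the conjugate mate of $\gamma$ if $T^*=B$. A curve is a general helix iff its harmonic curvature function $H$ is constant (the characterization used, taken as the definition). *)

theory Defs
  imports "HOL-Analysis.Analysis"
begin

section \<open>Smooth maps and manifolds\<close>

text \<open>Used only for open sets and for (relatively open subsets of) nondegenerate real intervals;
  on such sets the derivative relative to \<open>S\<close> is unique. At an endpoint of an interval
  it is the one-sided derivative.\<close>

primrec Ck_on :: "nat \<Rightarrow> 'a::real_normed_vector set \<Rightarrow> ('a \<Rightarrow> 'b::real_normed_vector) \<Rightarrow> bool" where
  "Ck_on 0 S f \<longleftrightarrow> continuous_on S f"
| "Ck_on (Suc k) S f \<longleftrightarrow> (\<forall>x\<in>S. f differentiable (at x within S)) \<and>
     (\<forall>v. Ck_on k S (\<lambda>x. frechet_derivative f (at x within S) v))"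

definition smooth_on :: "'a::real_normed_vector set \<Rightarrow> ('a \<Rightarrow> 'b::real_normed_vector) \<Rightarrow> bool" where
  "smooth_on S f \<longleftrightarrow> (\<forall>k. Ck_on k S f)"

type_synonym ('g, 'e) chart = "'g set \<times> ('g \<Rightarrow> 'e)"

definition smooth_atlas ::
  "('g::{t2_space, second_countable_topology}, 'e::euclidean_space) chart set \<Rightarrow> bool" where
  "smooth_atlas A \<longleftrightarrow>
     (\<forall>(U, \<phi>)\<in>A. open U \<and> open (\<phi> ` U) \<and> (\<exists>\<psi>. homeomorphism U (\<phi> ` U) \<phi> \<psi>)) \<and>
     (\<Union>(U, \<phi>)\<in>A. U) = UNIV \<and>
     (\<forall>(U, \<phi>)\<in>A. \<forall>(V, \<psi>)\<in>A. smooth_on (\<phi> ` (U \<inter> V)) (\<psi> \<circ> inv_into U \<phi>))"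

definition std_atlas :: "('e, 'e) chart set" where
  "std_atlas = {(UNIV, id)}"

definition prod_atlas ::
  "('g, 'e) chart set \<Rightarrow> ('h, 'f) chart set \<Rightarrow> ('g \<times> 'h, 'e \<times> 'f) chart set" where
  "prod_atlas A B = {(U \<times> V, map_prod \<phi> \<psi>) | U \<phi> V \<psi>. (U, \<phi>) \<in> A \<and> (V, \<psi>) \<in> B}"

definition smooth_map ::
  "('g::topological_space, 'e::real_normed_vector) chart set \<Rightarrow>
   ('h::topological_space, 'f::real_normed_vector) chart set \<Rightarrow> 'g set \<Rightarrow> ('g \<Rightarrow> 'h) \<Rightarrow> bool" where
  "smooth_map A B S F \<longleftrightarrow> continuous_on S F \<and>
     (\<forall>(U, \<phi>)\<in>A. \<forall>(V, \<psi>)\<in>B.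
        smooth_on (\<phi> ` (U \<inter> S \<inter> F -` V)) (\<psi> \<circ> F \<circ> inv_into U \<phi>))"

definition smooth_near ::
  "('g::topological_space, 'e::real_normed_vector) chart set \<Rightarrow> 'g \<Rightarrow> ('g \<Rightarrow> real) \<Rightarrow> bool" where
  "smooth_near A p f \<longleftrightarrow> (\<exists>W. open W \<and> p \<in> W \<and> smooth_map A std_atlas W f)"

section \<open>Tangent vectors and vector fields\<close>

text \<open>A tangent vector at \<open>p\<close> is a derivation at \<open>p\<close> on the functions that are smooth near \<open>p\<close>.
  It takes the value 0 on all other functions, so that equality of tangent vectors is equality
  of functions.\<close>

type_synonym 'g tvec = "('g \<Rightarrow> real) \<Rightarrow> real"
type_synonym 'g vfield = "'g \<Rightarrow> 'g tvec"

definition tangent_space ::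
  "('g::topological_space, 'e::real_normed_vector) chart set \<Rightarrow> 'g \<Rightarrow> 'g tvec set" where
  "tangent_space A p = {v.
     (\<forall>f. \<not> smooth_near A p f \<longrightarrow> v f = 0) \<and>
     (\<forall>c f. smooth_near A p f \<longrightarrow> v (\<lambda>x. c * f x) = c * v f) \<and>
     (\<forall>f h. smooth_near A p f \<longrightarrow> smooth_near A p h \<longrightarrow>
        v (\<lambda>x. f x + h x) = v f + v h \<and>
        v (\<lambda>x. f x * h x) = f p * v h + h p * v f)}"

definition vector_fields ::
  "('g::topological_space, 'e::real_normed_vector) chart set \<Rightarrow> 'g vfield set" where
  "vector_fields A = {X. (\<forall>p. X p \<in> tangent_space A p) \<and>
     (\<forall>W f. open W \<longrightarrow> smooth_map A std_atlas W f \<longrightarrow> smooth_map A std_atlas W (\<lambda>p. X p f))}"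

definition vf_add :: "'g vfield \<Rightarrow> 'g vfield \<Rightarrow> 'g vfield" where
  "vf_add X Y = (\<lambda>p f. X p f + Y p f)"

definition vf_scale :: "('g \<Rightarrow> real) \<Rightarrow> 'g vfield \<Rightarrow> 'g vfield" where
  "vf_scale h X = (\<lambda>p f. h p * X p f)"

definition lie_bracket ::
  "('g::topological_space, 'e::real_normed_vector) chart set \<Rightarrow>
   'g vfield \<Rightarrow> 'g vfield \<Rightarrow> 'g vfield" where
  "lie_bracket A X Y = (\<lambda>p f. if smooth_near A p f
     then X p (\<lambda>q. Y q f) - Y p (\<lambda>q. X q f) else 0)"

text \<open>The differential of \<open>F\<close>, applied to a tangent vector; used only for diffeomorphisms
  (translations), where no separate treatment of non-smooth functions is needed.\<close>

definition push :: "('g \<Rightarrow> 'h) \<Rightarrow> 'g tvec \<Rightarrow> 'h tvec" where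
  "push F v = (\<lambda>f. v (\<lambda>x. f (F x)))"

section \<open>Riemannian metrics and the Levi-Civita connection\<close>

type_synonym 'g metric = "'g \<Rightarrow> 'g tvec \<Rightarrow> 'g tvec \<Rightarrow> real"

definition riemannian_metric ::
  "('g::topological_space, 'e::real_normed_vector) chart set \<Rightarrow> 'g metric \<Rightarrow> bool" where
  "riemannian_metric A met \<longleftrightarrow>
     (\<forall>p. \<forall>v\<in>tangent_space A p. \<forall>w\<in>tangent_space A p. met p v w = met p w v) \<and>
     (\<forall>p. \<forall>u\<in>tangent_space A p. \<forall>v\<in>tangent_space A p. \<forall>w\<in>tangent_space A p. \<forall>a b.
        met p (\<lambda>f. a * u f + b * v f) w = a * met p u w + b * met p v w) \<and>
     (\<forall>p. \<forall>v\<in>tangent_space A p. v \<noteq> (\<lambda>_. 0) \<longrightarrow> met p v v > 0) \<and>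
     (\<forall>X\<in>vector_fields A. \<forall>Y\<in>vector_fields A.
        smooth_map A std_atlas UNIV (\<lambda>p. met p (X p) (Y p)))"

definition levi_civita ::
  "('g::topological_space, 'e::real_normed_vector) chart set \<Rightarrow> 'g metric \<Rightarrow>
   ('g vfield \<Rightarrow> 'g vfield \<Rightarrow> 'g vfield) \<Rightarrow> bool" where
  "levi_civita A met D \<longleftrightarrow>
     (\<forall>X\<in>vector_fields A. \<forall>Y\<in>vector_fields A. D X Y \<in> vector_fields A) \<and>
     (\<forall>X\<in>vector_fields A. \<forall>Y\<in>vector_fields A. \<forall>Z\<in>vector_fields A.
        D (vf_add X Y) Z = vf_add (D X Z) (D Y Z) \<and>
        D X (vf_add Y Z) = vf_add (D X Y) (D X Z)) \<and>
     (\<forall>X\<in>vector_fields A. \<forall>Y\<in>vector_fields A. \<forall>h. smooth_map A std_atlas UNIV h \<longrightarrow>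
        D (vf_scale h X) Y = vf_scale h (D X Y) \<and>
        D X (vf_scale h Y) = vf_add (vf_scale (\<lambda>p. X p h) Y) (vf_scale h (D X Y))) \<and>
     (\<forall>X\<in>vector_fields A. \<forall>Y\<in>vector_fields A.
        D X Y = vf_add (D Y X) (lie_bracket A X Y)) \<and>
     (\<forall>X\<in>vector_fields A. \<forall>Y\<in>vector_fields A. \<forall>Z\<in>vector_fields A. \<forall>p.
        X p (\<lambda>q. met q (Y q) (Z q)) = met p (D X Y p) (Z p) + met p (Y p) (D X Z p))"

section \<open>Lie groups with a bi-invariant metric\<close>

definition lie_group ::
  "('g::{t2_space, second_countable_topology}, 'e::euclidean_space) chart set \<Rightarrow>
   ('g \<Rightarrow> 'g \<Rightarrow> 'g) \<Rightarrow> 'g \<Rightarrow> ('g \<Rightarrow> 'g) \<Rightarrow> bool" where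
  "lie_group A mul e iv \<longleftrightarrow> smooth_atlas A \<and> group mul e iv \<and>
     smooth_map (prod_atlas A A) A UNIV (\<lambda>(x, y). mul x y) \<and> smooth_map A A UNIV iv"

definition lie_algebra ::
  "('g::topological_space, 'e::real_normed_vector) chart set \<Rightarrow> ('g \<Rightarrow> 'g \<Rightarrow> 'g) \<Rightarrow> 'g vfield set" where
  "lie_algebra A mul = {X \<in> vector_fields A. \<forall>g p. X (mul g p) = push (mul g) (X p)}"

definition bi_invariant ::
  "('g::topological_space, 'e::real_normed_vector) chart set \<Rightarrow> ('g \<Rightarrow> 'g \<Rightarrow> 'g) \<Rightarrow>
   'g metric \<Rightarrow> bool" where
  "bi_invariant A mul met \<longleftrightarrow> (\<forall>g p. \<forall>v\<in>tangent_space A p. \<forall>w\<in>tangent_space A p.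
     met (mul g p) (push (mul g) v) (push (mul g) w) = met p v w \<and>
     met (mul p g) (push (\<lambda>x. mul x g) v) (push (\<lambda>x. mul x g) w) = met p v w)"

text \<open>The left-invariant field with coordinates \<open>u\<close> in the basis \<open>X\<close>.\<close>

definition left_field :: "(3 \<Rightarrow> 'g vfield) \<Rightarrow> real^3 \<Rightarrow> 'g vfield" where
  "left_field X u = (\<lambda>p f. \<Sum>i\<in>UNIV. u $ i * X i p f)"

text \<open>An orthonormal basis of the Lie algebra. It also carries the orientation: the Lie algebra is
  oriented by declaring \<open>X 1, X 2, X 3\<close> to be positive.\<close>

definition orthonormal_basis ::
  "('g::topological_space, 'e::real_normed_vector) chart set \<Rightarrow> ('g \<Rightarrow> 'g \<Rightarrow> 'g) \<Rightarrow>
   'g metric \<Rightarrow> (3 \<Rightarrow> 'g vfield) \<Rightarrow> bool" where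
  "orthonormal_basis A mul met X \<longleftrightarrow>
     (\<forall>i. X i \<in> lie_algebra A mul) \<and>
     (\<forall>Z\<in>lie_algebra A mul. \<exists>u. Z = left_field X u) \<and>
     (\<forall>i j p. met p (X i p) (X j p) = (if i = j then 1 else 0))"

section \<open>Curves and their Frenet-Serret apparatus\<close>

text \<open>A vector field along a curve is given by its coordinate function \<open>u :: real \<Rightarrow> real^3\<close> with
  respect to the orthonormal basis \<open>X\<close>. Hence the inner product of two such fields is the standard
  inner product of the coordinates, and \<open>U'\<close> is the derivative of the coordinates.\<close>

definition velocity ::
  "('g::topological_space, 'e::real_normed_vector) chart set \<Rightarrow> real set \<Rightarrow> (real \<Rightarrow> 'g) \<Rightarrow>
   real \<Rightarrow> 'g tvec" where
  "velocity A I \<gamma> t = (\<lambda>f. if smooth_near A (\<gamma> t) f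
     then vector_derivative (f \<circ> \<gamma>) (at t within I) else 0)"

definition unit_speed_curve ::
  "('g::topological_space, 'e::real_normed_vector) chart set \<Rightarrow> 'g metric \<Rightarrow> real set \<Rightarrow>
   (real \<Rightarrow> 'g) \<Rightarrow> bool" where
  "unit_speed_curve A met I \<gamma> \<longleftrightarrow> smooth_map std_atlas A I \<gamma> \<and>
     (\<forall>t\<in>I. met (\<gamma> t) (velocity A I \<gamma> t) (velocity A I \<gamma> t) = 1)"

text \<open>For \<open>U = \<Sum>i. u\<^sub>i X\<^sub>i\<close> along a curve with tangent field \<open>T\<close> (in coordinates), the Leibniz rule
  for the connection gives \<open>\<nabla>\<^sub>T U = \<Sum>i. u\<^sub>i' X\<^sub>i + \<Sum>i. u\<^sub>i \<nabla>\<^sub>T X\<^sub>i\<close>. The second sum at \<open>t\<close> is the value at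
  \<open>\<gamma> t\<close> of the connection applied to the left-invariant fields with coordinates \<open>T t\<close> and \<open>U t\<close>;
  for a bi-invariant metric it equals half the bracket of these fields.\<close>

definition cov_deriv ::
  "'g metric \<Rightarrow> ('g vfield \<Rightarrow> 'g vfield \<Rightarrow> 'g vfield) \<Rightarrow> (3 \<Rightarrow> 'g vfield) \<Rightarrow> real set \<Rightarrow>
   (real \<Rightarrow> 'g) \<Rightarrow> (real \<Rightarrow> real^3) \<Rightarrow> (real \<Rightarrow> real^3) \<Rightarrow> real \<Rightarrow> real^3" where
  "cov_deriv met D X I \<gamma> T U t = vector_derivative U (at t within I) +
     (\<chi> k. met (\<gamma> t) (D (left_field X (T t)) (left_field X (U t)) (\<gamma> t)) (X k (\<gamma> t)))"

text \<open>Positive orientation of the frame is the positivity of the determinant of its coordinates.\<close>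

definition frenet_apparatus ::
  "('g::topological_space, 'e::real_normed_vector) chart set \<Rightarrow> 'g metric \<Rightarrow>
   ('g vfield \<Rightarrow> 'g vfield \<Rightarrow> 'g vfield) \<Rightarrow> (3 \<Rightarrow> 'g vfield) \<Rightarrow> real set \<Rightarrow> (real \<Rightarrow> 'g) \<Rightarrow>
   (real \<Rightarrow> real^3) \<Rightarrow> (real \<Rightarrow> real^3) \<Rightarrow> (real \<Rightarrow> real^3) \<Rightarrow> (real \<Rightarrow> real) \<Rightarrow> (real \<Rightarrow> real) \<Rightarrow> bool" where
  "frenet_apparatus A met D X I \<gamma> T N B \<kappa> \<tau> \<longleftrightarrow>
     unit_speed_curve A met I \<gamma> \<and>
     (\<forall>t\<in>I. velocity A I \<gamma> t = left_field X (T t) (\<gamma> t)) \<and>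
     smooth_on I T \<and> smooth_on I N \<and> smooth_on I B \<and>
     (\<forall>t\<in>I.
        norm (T t) = 1 \<and> norm (N t) = 1 \<and> norm (B t) = 1 \<and>
        T t \<bullet> N t = 0 \<and> N t \<bullet> B t = 0 \<and> B t \<bullet> T t = 0 \<and>
        det (vector [T t, N t, B t] :: real^3^3) > 0 \<and>
        \<kappa> t = norm (cov_deriv met D X I \<gamma> T T t) \<and> \<kappa> t > 0 \<and>
        cov_deriv met D X I \<gamma> T T t = \<kappa> t *\<^sub>R N t \<and>
        cov_deriv met D X I \<gamma> T N t = - \<kappa> t *\<^sub>R T t + \<tau> t *\<^sub>R B t \<and>
        cov_deriv met D X I \<gamma> T B t = - \<tau> t *\<^sub>R N t)"

definition frenet_curve ::
  "('g::topological_space, 'e::real_normed_vector) chart set \<Rightarrow> 'g metric \<Rightarrow>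
   ('g vfield \<Rightarrow> 'g vfield \<Rightarrow> 'g vfield) \<Rightarrow> (3 \<Rightarrow> 'g vfield) \<Rightarrow> real set \<Rightarrow> (real \<Rightarrow> 'g) \<Rightarrow>
   (real \<Rightarrow> real^3) \<Rightarrow> (real \<Rightarrow> real^3) \<Rightarrow> (real \<Rightarrow> real^3) \<Rightarrow> (real \<Rightarrow> real) \<Rightarrow> (real \<Rightarrow> real) \<Rightarrow> bool" where
  "frenet_curve A met D X I \<gamma> T N B \<kappa> \<tau> \<longleftrightarrow>
     frenet_apparatus A met D X I \<gamma> T N B \<kappa> \<tau> \<and> (\<forall>t\<in>I. \<tau> t \<noteq> 0)"

text \<open>The bracket and the inner product are those of the Lie algebra; for left-invariant fields the
  inner product does not depend on the point at which it is evaluated.\<close>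

definition lie_torsion ::
  "('g::topological_space, 'e::real_normed_vector) chart set \<Rightarrow> 'g metric \<Rightarrow> (3 \<Rightarrow> 'g vfield) \<Rightarrow>
   (real \<Rightarrow> 'g) \<Rightarrow> (real \<Rightarrow> real^3) \<Rightarrow> (real \<Rightarrow> real^3) \<Rightarrow> (real \<Rightarrow> real^3) \<Rightarrow> real \<Rightarrow> real" where
  "lie_torsion A met X \<gamma> T N B t = 1 / 2 *
     met (\<gamma> t) (lie_bracket A (left_field X (T t)) (left_field X (N t)) (\<gamma> t))
               (left_field X (B t) (\<gamma> t))"

definition harmonic_curvature ::
  "('g::topological_space, 'e::real_normed_vector) chart set \<Rightarrow> 'g metric \<Rightarrow> (3 \<Rightarrow> 'g vfield) \<Rightarrow>
   (real \<Rightarrow> 'g) \<Rightarrow> (real \<Rightarrow> real^3) \<Rightarrow> (real \<Rightarrow> real^3) \<Rightarrow> (real \<Rightarrow> real^3) \<Rightarrow>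
   (real \<Rightarrow> real) \<Rightarrow> (real \<Rightarrow> real) \<Rightarrow> real \<Rightarrow> real" where
  "harmonic_curvature A met X \<gamma> T N B \<kappa> \<tau> t = (\<tau> t - lie_torsion A met X \<gamma> T N B t) / \<kappa> t"

definition general_helix ::
  "('g::topological_space, 'e::real_normed_vector) chart set \<Rightarrow> 'g metric \<Rightarrow> (3 \<Rightarrow> 'g vfield) \<Rightarrow>
   real set \<Rightarrow> (real \<Rightarrow> 'g) \<Rightarrow> (real \<Rightarrow> real^3) \<Rightarrow> (real \<Rightarrow> real^3) \<Rightarrow> (real \<Rightarrow> real^3) \<Rightarrow>
   (real \<Rightarrow> real) \<Rightarrow> (real \<Rightarrow> real) \<Rightarrow> bool" where
  "general_helix A met X I \<gamma> T N B \<kappa> \<tau> \<longleftrightarrow>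
     (\<exists>c. \<forall>t\<in>I. harmonic_curvature A met X \<gamma> T N B \<kappa> \<tau> t = c)"

text \<open>\<open>\<gamma>s\<close>, with apparatus \<open>Ts, Ns, Bs, \<kappa>s, \<tau>s\<close>, is the conjugate mate of the curve with
  binormal field \<open>B\<close>. Fields along the two different curves are compared as Lie-algebra-valued maps,
  i.e. by their coordinates.\<close>

definition conjugate_mate ::
  "('g::topological_space, 'e::real_normed_vector) chart set \<Rightarrow> 'g metric \<Rightarrow>
   ('g vfield \<Rightarrow> 'g vfield \<Rightarrow> 'g vfield) \<Rightarrow> (3 \<Rightarrow> 'g vfield) \<Rightarrow> real set \<Rightarrow> (real \<Rightarrow> real^3) \<Rightarrow>
   (real \<Rightarrow> 'g) \<Rightarrow> (real \<Rightarrow> real^3) \<Rightarrow> (real \<Rightarrow> real^3) \<Rightarrow> (real \<Rightarrow> real^3) \<Rightarrow>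
   (real \<Rightarrow> real) \<Rightarrow> (real \<Rightarrow> real) \<Rightarrow> bool" where
  "conjugate_mate A met D X I B \<gamma>s Ts Ns Bs \<kappa>s \<tau>s \<longleftrightarrow>
     frenet_apparatus A met D X I \<gamma>s Ts Ns Bs \<kappa>s \<tau>s \<and> (\<forall>t\<in>I. Ts t = B t)"

end

theory Submission
  imports Defs
begin

text \<open>In an orthonormal basis of left-invariant fields the covariant derivative along a curve is
  \<open>\<nabla>\<^sub>T U = U' + Q(T, U)\<close>, where \<open>Q\<close> comes from the Levi-Civita connection of left-invariant fields. For a
  bi-invariant metric the form \<open>\<langle>Q(u, v), w\<rangle>\<close> is totally skew and equals \<open>1/2 \<langle>[u, v], w\<rangle>\<close>. The Frenet
  equations therefore read \<open>T' = \<kappa> N\<close> and \<open>B' = - (\<tau> - \<tau>\<^sub>G) N\<close> (lemma \<open>frenet_frame_derivatives\<close>): in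
  coordinates the curve behaves like a Euclidean one whose torsion is \<open>\<tau> - \<tau>\<^sub>G\<close>.

  For the conjugate mate this gives \<open>\<kappa>\<^sup>* N\<^sup>* = B' = - (\<tau> - \<tau>\<^sub>G) N\<close>, hence \<open>B\<^sup>* = \<sigma> T\<close> with a constant sign
  \<open>\<sigma>\<close>, and differentiating once more gives \<open>H H\<^sup>* = \<sigma>\<close> (lemma \<open>conjugate_mate_harmonic_curvature\<close>). Two
  functions whose product is a nonzero constant are constant together.

  The geometric input is the identity \<open>\<langle>[Z, Y], W\<rangle> + \<langle>Y, [Z, W]\<rangle> = 0\<close> for left-invariant fields (lemma
  \<open>lie_bracket_skew\<close>); with it, skewness of the connection form is linear algebra. Instead of
  differentiating the adjoint representation along flows, the proof expands left-invariant fields in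
  an orthonormal frame of right-invariant fields. These commute with left-invariant fields because
  left and right translations act on different factors of a product, so the bracket vanishes by
  symmetry of second derivatives (lemmas \<open>symmetric_second_derivative\<close> and \<open>mixed_partial_derivatives\<close>).
  As tangent vectors are abstract derivations, this requires knowing that they are directional
  derivatives in charts, which is Hadamard's lemma (lemma \<open>tangent_eq_frechet_derivative\<close>).\<close>

section \<open>Smooth maps on open sets\<close>

lemma Ck_on_cong_open:
  assumes "open S" "\<And>x. x \<in> S \<Longrightarrow> f x = g x" "Ck_on k S f"
  shows "Ck_on k S g"
  using assms(2,3)
proof (induction k arbitrary: f g)
  case 0
  then show ?case by (simp cong: continuous_on_cong)
next
  case (Suc k)
  have der: "(g has_derivative frechet_derivative f (at x within S)) (at x within S)" if "x \<in> S" for x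
  proof -
    have "(f has_derivative frechet_derivative f (at x within S)) (at x within S)"
      using Suc.prems(2) that by (simp add: frechet_derivative_works)
    then show ?thesis
      by (rule has_derivative_transform_within[OF _ zero_less_one that]) (simp add: Suc.prems(1))
  qed
  have eq: "frechet_derivative g (at x within S) = frechet_derivative f (at x within S)" if "x \<in> S" for x
    using der[OF that] frechet_derivative_at[of g _ x] at_within_open[OF that \<open>open S\<close>] by metis
  have "Ck_on k S (\<lambda>x. frechet_derivative g (at x within S) v)" for v
    by (rule Suc.IH[of "\<lambda>x. frechet_derivative f (at x within S) v"])
      (use Suc.prems(2) in \<open>auto simp: eq\<close>)
  then show ?case using der by (auto simp: differentiable_def)
qed

text \<open>Working with an arbitrary family \<open>f'\<close> of derivatives, rather than with the chosen one,
  lets each closure property below be proved by writing down the derivative.\<close>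

lemma Ck_on_Suc_iff:
  assumes "open S"
  shows "Ck_on (Suc k) S f \<longleftrightarrow>
    (\<exists>f'. (\<forall>x\<in>S. (f has_derivative f' x) (at x)) \<and> (\<forall>v. Ck_on k S (\<lambda>x. f' x v)))"
proof
  assume "Ck_on (Suc k) S f"
  then show "\<exists>f'. (\<forall>x\<in>S. (f has_derivative f' x) (at x)) \<and> (\<forall>v. Ck_on k S (\<lambda>x. f' x v))"
    using at_within_open[OF _ assms] frechet_derivative_works
    by (intro exI[of _ "\<lambda>x. frechet_derivative f (at x within S)"] conjI ballI) force+
next
  assume "\<exists>f'. (\<forall>x\<in>S. (f has_derivative f' x) (at x)) \<and> (\<forall>v. Ck_on k S (\<lambda>x. f' x v))"
  then obtain f' where f': "\<And>x. x \<in> S \<Longrightarrow> (f has_derivative f' x) (at x)"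
    "\<And>v. Ck_on k S (\<lambda>x. f' x v)" by blast
  have "frechet_derivative f (at x within S) = f' x" if "x \<in> S" for x
    using frechet_derivative_at[OF f'(1)[OF that]] at_within_open[OF that assms] by metis
  then have "Ck_on k S (\<lambda>x. frechet_derivative f (at x within S) v)" for v
    by (intro Ck_on_cong_open[where f = "\<lambda>x. f' x v", OF assms _ f'(2)]) simp
  then show "Ck_on (Suc k) S f"
    using f'(1) by (auto simp: differentiable_def at_within_open[OF _ assms])
qed

lemma Ck_on_SucI:
  assumes "open S" "\<And>x. x \<in> S \<Longrightarrow> (f has_derivative f' x) (at x)" "\<And>v. Ck_on k S (\<lambda>x. f' x v)"
  shows "Ck_on (Suc k) S f"
  using assms Ck_on_Suc_iff by blast

lemma Ck_on_SucE:
  assumes "open S" "Ck_on (Suc k) S f"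
  obtains f' where "\<And>x. x \<in> S \<Longrightarrow> (f has_derivative f' x) (at x)"
    "\<And>v. Ck_on k S (\<lambda>x. f' x v)"
proof -
  obtain f' where "(\<forall>x\<in>S. (f has_derivative f' x) (at x)) \<and> (\<forall>v. Ck_on k S (\<lambda>x. f' x v))"
    using assms(2) unfolding Ck_on_Suc_iff[OF assms(1)] ..
  then show thesis by (intro that[of f']) auto
qed

lemma Ck_on_imp_continuous_on: "Ck_on k S f \<Longrightarrow> continuous_on S f"
  by (cases k) (auto intro: differentiable_imp_continuous_on simp: differentiable_on_def)

lemma Ck_on_mono:
  assumes "open S" "open T" "T \<subseteq> S" "Ck_on k S f"
  shows "Ck_on k T f"
  using assms(4)
proof (induction k arbitrary: f)
  case 0
  then show ?case using assms(3) continuous_on_subset by auto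
next
  case (Suc k)
  obtain f' where "\<And>x. x \<in> S \<Longrightarrow> (f has_derivative f' x) (at x)"
    "\<And>v. Ck_on k S (\<lambda>x. f' x v)"
    using Ck_on_SucE[OF assms(1) Suc.prems] by blast
  then show ?case
    using Suc.IH assms(3) by (intro Ck_on_SucI[OF assms(2), of f f']) auto
qed

lemma Ck_on_local:
  assumes "open S" "\<And>x. x \<in> S \<Longrightarrow> \<exists>T. open T \<and> x \<in> T \<and> T \<subseteq> S \<and> Ck_on k T f"
  shows "Ck_on k S f"
  using assms(2)
proof (induction k arbitrary: f)
  case 0
  have "isCont f x" if "x \<in> S" for x
    using 0[OF that] by (auto simp: continuous_on_eq_continuous_at)
  then show ?case by (simp add: continuous_at_imp_continuous_on)
next
  case (Suc k)
  let ?f' = "\<lambda>x. frechet_derivative f (at x)"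
  have loc: "\<exists>T. open T \<and> x \<in> T \<and> T \<subseteq> S \<and> (\<forall>y\<in>T. (f has_derivative ?f' y) (at y)) \<and>
      (\<forall>v. Ck_on k T (\<lambda>x. ?f' x v))" if x: "x \<in> S" for x
  proof -
    obtain T where T: "open T" "x \<in> T" "T \<subseteq> S" "Ck_on (Suc k) T f"
      using Suc.prems[OF x] by blast
    obtain f' where f': "\<And>x. x \<in> T \<Longrightarrow> (f has_derivative f' x) (at x)"
      "\<And>v. Ck_on k T (\<lambda>x. f' x v)" using Ck_on_SucE[OF T(1,4)] by blast
    have eq: "f' y = ?f' y" if "y \<in> T" for y
      using frechet_derivative_at[OF f'(1)[OF that]] .
    have "Ck_on k T (\<lambda>x. ?f' x v)" for v
      by (rule Ck_on_cong_open[OF T(1) _ f'(2)[of v]]) (simp add: eq)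
    then show ?thesis
      using f'(1) eq by (intro exI[of _ T] conjI T(1-3) ballI allI) simp_all
  qed
  have "Ck_on k S (\<lambda>x. ?f' x v)" for v
  proof (rule Suc.IH)
    fix x assume "x \<in> S"
    from loc[OF this] obtain T where "open T" "x \<in> T" "T \<subseteq> S" "\<forall>v. Ck_on k T (\<lambda>x. ?f' x v)"
      by (elim exE conjE)
    then show "\<exists>T. open T \<and> x \<in> T \<and> T \<subseteq> S \<and> Ck_on k T (\<lambda>x. ?f' x v)"
      by (intro exI[of _ T]) simp
  qed
  moreover have "(f has_derivative ?f' x) (at x)" if "x \<in> S" for x
    using loc[OF that] by blast
  ultimately show ?case by (intro Ck_on_SucI[OF assms(1), of f ?f'])
qed

lemma Ck_on_SucD:
  assumes "open S" "Ck_on (Suc k) S f"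
  shows "Ck_on k S f"
  using assms(2)
proof (induction k arbitrary: f)
  case 0
  then show ?case using Ck_on_imp_continuous_on by fastforce
next
  case (Suc k)
  obtain f' where "\<And>x. x \<in> S \<Longrightarrow> (f has_derivative f' x) (at x)"
    "\<And>v. Ck_on (Suc k) S (\<lambda>x. f' x v)"
    using Ck_on_SucE[OF assms(1) Suc.prems] by blast
  then show ?case using Suc.IH by (intro Ck_on_SucI[OF assms(1), of f f']) auto
qed

lemma Ck_on_const: "open S \<Longrightarrow> Ck_on k S (\<lambda>x. c)"
proof (induction k arbitrary: c)
  case (Suc k)
  then show ?case by (intro Ck_on_SucI[of S _ "\<lambda>_ _. 0"]) (auto intro!: derivative_eq_intros)
qed simp

lemma Ck_on_bounded_linear:
  assumes "bounded_linear L" "open S"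
  shows "Ck_on k S L"
proof (cases k)
  case 0
  then show ?thesis by (simp add: linear_continuous_on[OF assms(1)])
next
  case (Suc m)
  have "(L has_derivative L) (at x)" for x
    by (rule bounded_linear_imp_has_derivative[OF assms(1)])
  then show ?thesis unfolding Suc
    by (intro Ck_on_SucI[OF assms(2), of L "\<lambda>_. L"] Ck_on_const assms(2))
qed

lemma Ck_on_bounded_linear_compose:
  assumes "bounded_linear L" "open S" "Ck_on k S f"
  shows "Ck_on k S (\<lambda>x. L (f x))"
  using assms(3)
proof (induction k arbitrary: f)
  case 0
  then show ?case using bounded_linear.continuous_on[OF assms(1)] by auto
next
  case (Suc k)
  obtain f' where f': "\<And>x. x \<in> S \<Longrightarrow> (f has_derivative f' x) (at x)"
    "\<And>v. Ck_on k S (\<lambda>x. f' x v)"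
    using Ck_on_SucE[OF assms(2) Suc.prems] by blast
  show ?case
    by (rule Ck_on_SucI[OF assms(2), of _ "\<lambda>x v. L (f' x v)"])
      (auto intro: f' Suc.IH bounded_linear.has_derivative[OF assms(1)])
qed

lemma Ck_on_add:
  assumes "open S" "Ck_on k S f" "Ck_on k S g"
  shows "Ck_on k S (\<lambda>x. f x + g x)"
  using assms(2,3)
proof (induction k arbitrary: f g)
  case 0
  then show ?case by (simp add: continuous_on_add)
next
  case (Suc k)
  obtain f' where f': "\<And>x. x \<in> S \<Longrightarrow> (f has_derivative f' x) (at x)"
    "\<And>v. Ck_on k S (\<lambda>x. f' x v)"
    using Ck_on_SucE[OF assms(1) Suc.prems(1)] by blast
  obtain g' where g': "\<And>x. x \<in> S \<Longrightarrow> (g has_derivative g' x) (at x)"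
    "\<And>v. Ck_on k S (\<lambda>x. g' x v)"
    using Ck_on_SucE[OF assms(1) Suc.prems(2)] by blast
  show ?case
    by (rule Ck_on_SucI[OF assms(1), of _ "\<lambda>x v. f' x v + g' x v"])
      (auto intro: f' g' Suc.IH has_derivative_add)
qed

lemma Ck_on_bounded_bilinear:
  assumes "bounded_bilinear bil" "open S" "Ck_on k S f" "Ck_on k S g"
  shows "Ck_on k S (\<lambda>x. bil (f x) (g x))"
  using assms(3,4)
proof (induction k arbitrary: f g)
  case 0
  then show ?case using bounded_bilinear.continuous_on[OF assms(1)] by auto
next
  case (Suc k)
  obtain f' where f': "\<And>x. x \<in> S \<Longrightarrow> (f has_derivative f' x) (at x)"
    "\<And>v. Ck_on k S (\<lambda>x. f' x v)"
    using Ck_on_SucE[OF assms(2) Suc.prems(1)] by blast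
  obtain g' where g': "\<And>x. x \<in> S \<Longrightarrow> (g has_derivative g' x) (at x)"
    "\<And>v. Ck_on k S (\<lambda>x. g' x v)"
    using Ck_on_SucE[OF assms(2) Suc.prems(2)] by blast
  have fg: "Ck_on k S f" "Ck_on k S g" using Suc.prems Ck_on_SucD[OF assms(2)] by auto
  show ?case
    by (rule Ck_on_SucI[OF assms(2), of _ "\<lambda>x v. bil (f x) (g' x v) + bil (f' x v) (g x)"])
      (auto intro!: f' g' fg Suc.IH Ck_on_add[OF assms(2)]
        bounded_bilinear.FDERIV[OF assms(1)])
qed

lemma Ck_on_sum:
  assumes "open S" "\<And>i. i \<in> J \<Longrightarrow> Ck_on k S (f i)"
  shows "Ck_on k S (\<lambda>x. \<Sum>i\<in>J. f i x)"
  using assms(2)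
  by (induction J rule: infinite_finite_induct) (auto intro!: Ck_on_add Ck_on_const assms(1))

text \<open>The chain rule gives \<open>g' (f x) (f' x v)\<close>, in which the direction fed to \<open>g'\<close> moves with \<open>x\<close>,
  whereas the induction hypothesis concerns \<open>g'\<close> in fixed directions. Expanding \<open>f' x v\<close> in the
  standard basis resolves this, and is the reason why the middle space is Euclidean.\<close>

lemma Ck_on_compose:
  fixes f :: "'a::real_normed_vector \<Rightarrow> 'b::euclidean_space"
    and g :: "'b \<Rightarrow> 'c::real_normed_vector"
  assumes "open S" "open T" "\<And>x. x \<in> S \<Longrightarrow> f x \<in> T" "Ck_on k S f" "Ck_on k T g"
  shows "Ck_on k S (\<lambda>x. g (f x))"
  using assms(4,5)
proof (induction k arbitrary: g)
  case 0
  then show ?case using assms(3) by (auto intro: continuous_on_compose2)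
next
  case (Suc k)
  obtain f' where f': "\<And>x. x \<in> S \<Longrightarrow> (f has_derivative f' x) (at x)"
    "\<And>v. Ck_on k S (\<lambda>x. f' x v)"
    using Ck_on_SucE[OF assms(1) Suc.prems(1)] by blast
  obtain g' where g': "\<And>x. x \<in> T \<Longrightarrow> (g has_derivative g' x) (at x)"
    "\<And>v. Ck_on k T (\<lambda>x. g' x v)"
    using Ck_on_SucE[OF assms(2) Suc.prems(2)] by blast
  have fk: "Ck_on k S f" using Suc.prems Ck_on_SucD[OF assms(1)] by auto
  have expand: "g' (f x) (f' x v) = (\<Sum>b\<in>Basis. (f' x v \<bullet> b) *\<^sub>R g' (f x) b)" if "x \<in> S" for x v
  proof -
    interpret linear "g' (f x)" using g'(1)[OF assms(3)[OF that]] by (rule has_derivative_linear)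
    have "g' (f x) (f' x v) = g' (f x) (\<Sum>b\<in>Basis. (f' x v \<bullet> b) *\<^sub>R b)"
      by (simp only: euclidean_representation)
    also have "\<dots> = (\<Sum>b\<in>Basis. (f' x v \<bullet> b) *\<^sub>R g' (f x) b)" by (simp only: sum scale)
    finally show ?thesis .
  qed
  have "Ck_on k S (\<lambda>x. \<Sum>b\<in>Basis. (f' x v \<bullet> b) *\<^sub>R g' (f x) b)" for v
    by (intro Ck_on_sum assms(1) Ck_on_bounded_bilinear[OF bounded_bilinear_scaleR]
        Ck_on_bounded_linear_compose[OF bounded_linear_inner_left] f' Suc.IH fk g')
  then have "Ck_on k S (\<lambda>x. g' (f x) (f' x v))" for v
    by (rule Ck_on_cong_open[OF assms(1), rotated]) (simp add: expand)
  moreover have "((\<lambda>x. g (f x)) has_derivative (\<lambda>v. g' (f x) (f' x v))) (at x)" if "x \<in> S" for x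
    using has_derivative_compose[OF f'(1)[OF that] g'(1)[OF assms(3)[OF that]]] .
  ultimately show ?case by (intro Ck_on_SucI[OF assms(1)])
qed

lemma smooth_on_cong_open:
  "open S \<Longrightarrow> smooth_on S f \<Longrightarrow> (\<And>x. x \<in> S \<Longrightarrow> f x = g x) \<Longrightarrow> smooth_on S g"
  unfolding smooth_on_def by (intro allI, rule Ck_on_cong_open[of S f]) auto

lemma smooth_on_mono: "smooth_on S f \<Longrightarrow> open S \<Longrightarrow> open T \<Longrightarrow> T \<subseteq> S \<Longrightarrow> smooth_on T f"
  unfolding smooth_on_def by (intro allI, rule Ck_on_mono[of S]) auto

lemma smooth_on_local:
  assumes "open S" "\<And>x. x \<in> S \<Longrightarrow> \<exists>T. open T \<and> x \<in> T \<and> T \<subseteq> S \<and> smooth_on T f"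
  shows "smooth_on S f"
  unfolding smooth_on_def
proof (intro allI Ck_on_local[OF assms(1)])
  fix k x assume "x \<in> S"
  then obtain T where "open T" "x \<in> T" "T \<subseteq> S" "smooth_on T f" using assms(2) by meson
  then show "\<exists>T. open T \<and> x \<in> T \<and> T \<subseteq> S \<and> Ck_on k T f"
    by (intro exI[of _ T]) (simp add: smooth_on_def)
qed

lemma smooth_on_const: "open S \<Longrightarrow> smooth_on S (\<lambda>x. c)"
  by (simp add: smooth_on_def Ck_on_const)

lemma smooth_on_bounded_linear: "bounded_linear L \<Longrightarrow> open S \<Longrightarrow> smooth_on S L"
  by (simp add: smooth_on_def Ck_on_bounded_linear)

lemma smooth_on_add:
  "open S \<Longrightarrow> smooth_on S f \<Longrightarrow> smooth_on S g \<Longrightarrow> smooth_on S (\<lambda>x. f x + g x)"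
  by (simp add: smooth_on_def Ck_on_add)

lemma smooth_on_mult:
  fixes f g :: "'a::real_normed_vector \<Rightarrow> real"
  shows "open S \<Longrightarrow> smooth_on S f \<Longrightarrow> smooth_on S g \<Longrightarrow> smooth_on S (\<lambda>x. f x * g x)"
  by (simp add: smooth_on_def Ck_on_bounded_bilinear[OF bounded_bilinear_mult])

lemma smooth_on_compose:
  fixes f :: "'a::real_normed_vector \<Rightarrow> 'b::euclidean_space"
  assumes "open S" "open T" "smooth_on S f" "smooth_on T g" "\<And>x. x \<in> S \<Longrightarrow> f x \<in> T"
  shows "smooth_on S (\<lambda>x. g (f x))"
  unfolding smooth_on_def
proof
  fix k
  have "Ck_on k S f" "Ck_on k T g" using assms(3,4) by (auto simp: smooth_on_def)
  then show "Ck_on k S (\<lambda>x. g (f x))"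
    using Ck_on_compose[of S T f k g] assms(1,2,5) by blast
qed

lemma smooth_on_Pair_const:
  assumes "open S"
  shows "smooth_on S (\<lambda>y. (y, z))" and "smooth_on S (\<lambda>y. (z, y))"
proof -
  have "smooth_on S (\<lambda>y. (y, 0) + (0, z))" "smooth_on S (\<lambda>y. (z, 0) + (0, y))"
    by (intro smooth_on_add smooth_on_const smooth_on_bounded_linear assms
        bounded_linear_Pair bounded_linear_zero bounded_linear_ident)+
  then show "smooth_on S (\<lambda>y. (y, z))" "smooth_on S (\<lambda>y. (z, y))" by simp_all
qed

lemma smooth_on_has_derivative:
  assumes "open S" "smooth_on S f" "x \<in> S"
  shows "(f has_derivative frechet_derivative f (at x)) (at x)"
proof -
  have "Ck_on (Suc 0) S f" using assms(2) unfolding smooth_on_def by blast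
  then show ?thesis
    using assms(3) by (simp add: frechet_derivative_works at_within_open[OF _ assms(1)])
qed

lemma smooth_on_frechet_derivative:
  assumes "open S" "smooth_on S f"
  shows "smooth_on S (\<lambda>x. frechet_derivative f (at x) v)"
  unfolding smooth_on_def
proof
  fix k
  have "Ck_on (Suc k) S f" using assms(2) unfolding smooth_on_def by blast
  then have "Ck_on k S (\<lambda>x. frechet_derivative f (at x within S) v)" by simp
  then show "Ck_on k S (\<lambda>x. frechet_derivative f (at x) v)"
    by (rule Ck_on_cong_open[OF assms(1), rotated]) (simp add: at_within_open[OF _ assms(1)])
qed

lemma smooth_on_imp_continuous_on: "smooth_on S f \<Longrightarrow> continuous_on S f"
  unfolding smooth_on_def using Ck_on_imp_continuous_on by blast

text \<open>The symmetry of second derivatives is read off the second difference of \<open>F\<close> over a small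
  parallelogram: two applications of the mean value theorem express it through the derivative first
  along \<open>u\<close> and then along \<open>v\<close>, and it does not change when \<open>u\<close> and \<open>v\<close> are exchanged.\<close>

lemma second_difference_mean_value:
  fixes F :: "'a::real_normed_vector \<Rightarrow> real"
  assumes "open S" "smooth_on S F" "0 < h"
    and box: "\<And>s t. 0 \<le> s \<Longrightarrow> s \<le> h \<Longrightarrow> 0 \<le> t \<Longrightarrow> t \<le> h \<Longrightarrow> c + s *\<^sub>R u + t *\<^sub>R v \<in> S"
  obtains s t where "0 < s" "s < h" "0 < t" "t < h"
    "F (c + h *\<^sub>R u + h *\<^sub>R v) - F (c + h *\<^sub>R u) - F (c + h *\<^sub>R v) + F c =
     h * h * frechet_derivative (\<lambda>x. frechet_derivative F (at x) u) (at (c + s *\<^sub>R u + t *\<^sub>R v)) v"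
proof -
  let ?G = "\<lambda>x. frechet_derivative F (at x) u"
  have along: "((\<lambda>s. K (a + s *\<^sub>R w)) has_real_derivative frechet_derivative K (at (a + s *\<^sub>R w)) w) (at s)"
    if "smooth_on S K" "a + s *\<^sub>R w \<in> S" for K :: "'a \<Rightarrow> real" and a w s
  proof -
    have K: "(K has_derivative frechet_derivative K (at (a + s *\<^sub>R w))) (at (a + s *\<^sub>R w))"
      using smooth_on_has_derivative[OF assms(1) that] .
    have "((\<lambda>s. a + s *\<^sub>R w) has_derivative (\<lambda>r. r *\<^sub>R w)) (at s)"
      by (auto intro!: derivative_eq_intros)
    from has_derivative_compose[OF this K]
    show ?thesis
      using linear_cmul[OF has_derivative_linear[OF K]]
      by (simp add: has_field_derivative_def mult_commute_abs)
  qed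
  have "\<exists>s. 0 < s \<and> s < h \<and>
      (F (c + h *\<^sub>R v + h *\<^sub>R u) - F (c + h *\<^sub>R u)) - (F (c + h *\<^sub>R v + 0 *\<^sub>R u) - F (c + 0 *\<^sub>R u)) =
      (h - 0) * (?G (c + h *\<^sub>R v + s *\<^sub>R u) - ?G (c + s *\<^sub>R u))"
  proof (rule MVT2[OF assms(3)])
    fix s assume s: "0 \<le> s" "s \<le> h"
    have "c + h *\<^sub>R v + s *\<^sub>R u \<in> S" "c + s *\<^sub>R u \<in> S"
      using box[OF s, of h] box[OF s, of 0] assms(3) by (simp_all add: ac_simps)
    then show "((\<lambda>s. F (c + h *\<^sub>R v + s *\<^sub>R u) - F (c + s *\<^sub>R u)) has_real_derivative
        ?G (c + h *\<^sub>R v + s *\<^sub>R u) - ?G (c + s *\<^sub>R u)) (at s)"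
      by (intro DERIV_diff along assms(2))
  qed
  then obtain s where s: "0 < s" "s < h" and
    eq1: "F (c + h *\<^sub>R u + h *\<^sub>R v) - F (c + h *\<^sub>R u) - F (c + h *\<^sub>R v) + F c =
      h * (?G (c + s *\<^sub>R u + h *\<^sub>R v) - ?G (c + s *\<^sub>R u + 0 *\<^sub>R v))"
    by (auto simp: ac_simps)
  have "\<exists>t. 0 < t \<and> t < h \<and> ?G (c + s *\<^sub>R u + h *\<^sub>R v) - ?G (c + s *\<^sub>R u + 0 *\<^sub>R v) =
      (h - 0) * frechet_derivative ?G (at (c + s *\<^sub>R u + t *\<^sub>R v)) v"
  proof (rule MVT2[OF assms(3)])
    fix t assume t: "0 \<le> t" "t \<le> h"
    show "((\<lambda>t. ?G (c + s *\<^sub>R u + t *\<^sub>R v)) has_real_derivative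
        frechet_derivative ?G (at (c + s *\<^sub>R u + t *\<^sub>R v)) v) (at t)"
      by (rule along[OF smooth_on_frechet_derivative[OF assms(1,2)]]) (use s t box in auto)
  qed
  then obtain t where "0 < t" "t < h"
    "?G (c + s *\<^sub>R u + h *\<^sub>R v) - ?G (c + s *\<^sub>R u + 0 *\<^sub>R v) =
      h * frechet_derivative ?G (at (c + s *\<^sub>R u + t *\<^sub>R v)) v" by auto
  with that s eq1 show thesis by auto
qed

text \<open>If the two mixed derivatives differed at \<open>c\<close>, they would by continuity take disjoint sets of
  values near \<open>c\<close>; but the second difference over a parallelogram with sides \<open>h u\<close> and \<open>h v\<close>,
  divided by \<open>h\<^sup>2\<close>, is a value of both.\<close>

lemma symmetric_second_derivative:
  fixes F :: "'a::real_normed_vector \<Rightarrow> real"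
  assumes "open S" "smooth_on S F" "c \<in> S"
  shows "frechet_derivative (\<lambda>x. frechet_derivative F (at x) u) (at c) v =
         frechet_derivative (\<lambda>x. frechet_derivative F (at x) v) (at c) u"
    (is "?P c = ?Q c")
proof (rule ccontr)
  assume ne: "?P c \<noteq> ?Q c"
  define \<epsilon> where "\<epsilon> = \<bar>?P c - ?Q c\<bar> / 2"
  have \<epsilon>: "\<epsilon> > 0" using ne by (simp add: \<epsilon>_def)
  have cont: "continuous_on S ?P" "continuous_on S ?Q"
    by (intro smooth_on_imp_continuous_on smooth_on_frechet_derivative assms)+
  obtain d1 where d1: "d1 > 0" "\<And>x. x \<in> S \<Longrightarrow> dist x c < d1 \<Longrightarrow> dist (?P x) (?P c) < \<epsilon>"
    using cont(1) \<epsilon> assms(3) unfolding continuous_on_iff by metis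
  obtain d2 where d2: "d2 > 0" "\<And>x. x \<in> S \<Longrightarrow> dist x c < d2 \<Longrightarrow> dist (?Q x) (?Q c) < \<epsilon>"
    using cont(2) \<epsilon> assms(3) unfolding continuous_on_iff by metis
  obtain d3 where d3: "d3 > 0" "\<And>x. dist x c < d3 \<Longrightarrow> x \<in> S"
    using assms(1,3) unfolding open_dist by metis
  \<comment> \<open>The parallelogram with sides \<open>h u\<close> and \<open>h v\<close> at \<open>c\<close> lies in the ball of radius \<open>d\<close>.\<close>
  define d where "d = min d1 (min d2 d3)"
  define h where "h = d / (2 * (norm u + norm v + 1))"
  have d: "d > 0" using d1(1) d2(1) d3(1) by (simp add: d_def)
  have pos: "norm u + norm v + 1 > 0" by (smt (verit) norm_ge_zero)
  have h: "h > 0" using d pos by (simp add: h_def)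
  have near: "dist (c + s *\<^sub>R u + t *\<^sub>R v) c < d" if "0 \<le> s" "s \<le> h" "0 \<le> t" "t \<le> h" for s t
  proof -
    have "dist (c + s *\<^sub>R u + t *\<^sub>R v) c = norm (s *\<^sub>R u + t *\<^sub>R v)" by (simp add: dist_norm)
    also have "\<dots> \<le> \<bar>s\<bar> * norm u + \<bar>t\<bar> * norm v" by (metis norm_scaleR norm_triangle_ineq)
    also have "\<dots> \<le> h * norm u + h * norm v" using that by (intro add_mono mult_right_mono) auto
    also have "\<dots> < h * (2 * (norm u + norm v + 1))" using h pos
      by (simp add: algebra_simps add_nonneg_pos)
    also have "\<dots> = d" using pos unfolding h_def by (subst nonzero_eq_divide_eq[symmetric]) simp_all
    finally show ?thesis .
  qed
  have near': "dist (c + s *\<^sub>R v + t *\<^sub>R u) c < d" if "0 \<le> s" "s \<le> h" "0 \<le> t" "t \<le> h" for s t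
    using near[of t s] that by (simp add: ac_simps)
  have inS: "x \<in> S" if "dist x c < d" for x using that d3 by (simp add: d_def)
  obtain s t where 1: "0 < s" "s < h" "0 < t" "t < h"
    "F (c + h *\<^sub>R u + h *\<^sub>R v) - F (c + h *\<^sub>R u) - F (c + h *\<^sub>R v) + F c =
      h * h * ?P (c + s *\<^sub>R u + t *\<^sub>R v)"
    using second_difference_mean_value[OF assms(1,2) h inS[OF near]] by blast
  obtain s' t' where 2: "0 < s'" "s' < h" "0 < t'" "t' < h"
    "F (c + h *\<^sub>R v + h *\<^sub>R u) - F (c + h *\<^sub>R v) - F (c + h *\<^sub>R u) + F c =
      h * h * ?Q (c + s' *\<^sub>R v + t' *\<^sub>R u)"
    using second_difference_mean_value[OF assms(1,2) h inS[OF near']] by blast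
  have swap: "c + h *\<^sub>R v + h *\<^sub>R u = c + h *\<^sub>R u + h *\<^sub>R v" by (simp only: ac_simps)
  have "h * h * ?P (c + s *\<^sub>R u + t *\<^sub>R v) = h * h * ?Q (c + s' *\<^sub>R v + t' *\<^sub>R u)"
    using 1(5) 2(5)[unfolded swap] by linarith
  then have "?P (c + s *\<^sub>R u + t *\<^sub>R v) = ?Q (c + s' *\<^sub>R v + t' *\<^sub>R u)" using h by simp
  moreover have "dist (?P (c + s *\<^sub>R u + t *\<^sub>R v)) (?P c) < \<epsilon>"
    using near[of s t] 1 by (intro d1(2) inS) (auto simp: d_def)
  moreover have "dist (?Q (c + s' *\<^sub>R v + t' *\<^sub>R u)) (?Q c) < \<epsilon>"
    using near'[of s' t'] 2 by (intro d2(2) inS) (auto simp: d_def)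
  moreover have False if "y = z" "dist y p < \<bar>p - q\<bar> / 2" "dist z q < \<bar>p - q\<bar> / 2" for y z p q :: real
  proof -
    have "\<bar>p - q\<bar> \<le> dist y p + dist z q" using that(1) by (simp add: dist_real_def)
    moreover have "dist y p + dist z q < \<bar>p - q\<bar>"
      using add_strict_mono[OF that(2,3)] by (simp only: field_sum_of_halves)
    ultimately show ?thesis by simp
  qed
  ultimately show False unfolding \<epsilon>_def by blast
qed

text \<open>Differentiation under the integral sign turns the weight \<open>t ^ m\<close> into \<open>t ^ Suc m\<close>, because the inner
  map \<open>x \<mapsto> a + t (x - a)\<close> contracts by \<open>t\<close>. Keeping the power of \<open>t\<close> general makes the induction close.\<close>

lemma Ck_on_integral_segment:
  fixes h :: "'a::euclidean_space \<Rightarrow> real"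
  assumes "open C" "convex C" "a \<in> C" "Ck_on k C h"
  shows "Ck_on k C (\<lambda>x. integral (cbox 0 1) (\<lambda>t. t ^ m * h (a + t *\<^sub>R (x - a))))"
  using assms(4)
proof (induction k arbitrary: h m)
  case 0
  have seg: "a + t *\<^sub>R (x - a) \<in> C" if "x \<in> C" "t \<in> cbox 0 1" for x t
    using convexD_alt[OF assms(2,3) that(1), of t] that(2) by (simp add: algebra_simps)
  have "continuous_on (C \<times> cbox 0 1) (\<lambda>p. h (a + snd p *\<^sub>R (fst p - a)))"
    by (rule continuous_on_compose2[of C h]) (use 0 seg in \<open>auto intro!: continuous_intros\<close>)
  then have "continuous_on (C \<times> cbox 0 1) (\<lambda>(x, t). t ^ m * h (a + t *\<^sub>R (x - a)))"
    by (auto simp: case_prod_beta intro!: continuous_intros)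
  then show ?case by (simp only: Ck_on.simps) (rule integral_continuous_on_param)
next
  case (Suc k)
  obtain h' where h': "\<And>x. x \<in> C \<Longrightarrow> (h has_derivative h' x) (at x)"
    "\<And>v. Ck_on k C (\<lambda>x. h' x v)"
    using Ck_on_SucE[OF assms(1) Suc.prems] by blast
  have seg: "a + t *\<^sub>R (x - a) \<in> C" if "x \<in> C" "t \<in> cbox 0 1" for x t
    using convexD_alt[OF assms(2,3) that(1), of t] that(2) by (simp add: algebra_simps)
  define f' where "f' x t = Blinfun (\<lambda>v. t ^ Suc m * h' (a + t *\<^sub>R (x - a)) v)" for x t
  have f': "blinfun_apply (f' x t) = (\<lambda>v. t ^ Suc m * h' (a + t *\<^sub>R (x - a)) v)"
    if "x \<in> C" "t \<in> cbox 0 1" for x t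
    unfolding f'_def
    by (intro bounded_linear_Blinfun_apply bounded_linear_const_mult
        has_derivative_bounded_linear[OF h'(1)] seg that)
  have cont_h': "continuous_on (C \<times> cbox 0 1) (\<lambda>p. h' (a + snd p *\<^sub>R (fst p - a)) v)" for v
    by (rule continuous_on_compose2[of C "\<lambda>y. h' y v"])
      (use Ck_on_imp_continuous_on[OF h'(2)] seg in \<open>auto intro!: continuous_intros\<close>)
  have cont_f': "continuous_on (C \<times> cbox 0 1) (\<lambda>p. f' (fst p) (snd p))"
  proof (rule continuous_on_blinfun_componentwise)
    fix v :: 'a assume "v \<in> Basis"
    have "continuous_on (C \<times> cbox 0 1) (\<lambda>p. snd p ^ Suc m * h' (a + snd p *\<^sub>R (fst p - a)) v)"
      by (intro continuous_intros cont_h')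
    then show "continuous_on (C \<times> cbox 0 1) (\<lambda>p. blinfun_apply (f' (fst p) (snd p)) v)"
      by (rule continuous_on_eq) (auto simp: f')
  qed
  have hcont: "continuous_on C h" using Ck_on_imp_continuous_on[OF Suc.prems] .
  have integrable: "(\<lambda>t. t ^ m * h (a + t *\<^sub>R (x - a))) integrable_on cbox 0 1" if "x \<in> C" for x
    by (intro integrable_continuous continuous_intros continuous_on_compose2[OF hcont])
      (use seg that in auto)
  have der: "((\<lambda>x. integral (cbox 0 1) (\<lambda>t. t ^ m * h (a + t *\<^sub>R (x - a))))
      has_derivative (\<lambda>v. integral (cbox 0 1) (\<lambda>t. t ^ Suc m * h' (a + t *\<^sub>R (x - a)) v))) (at x)"
    if x: "x \<in> C" for x
  proof -
    have "((\<lambda>x. integral (cbox 0 1) (\<lambda>t. t ^ m * h (a + t *\<^sub>R (x - a))))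
      has_derivative integral (cbox 0 1) (f' x)) (at x within C)"
    proof (rule leibniz_rule[OF _ integrable _ x assms(2)])
      fix y and t :: real assume yt: "y \<in> C" "t \<in> cbox 0 1"
      have "((\<lambda>y. a + t *\<^sub>R (y - a)) has_derivative (\<lambda>v. t *\<^sub>R v)) (at y)"
        by (auto intro!: derivative_eq_intros)
      from has_derivative_compose[OF this h'(1)[OF seg[OF yt]]]
      have "((\<lambda>y. h (a + t *\<^sub>R (y - a))) has_derivative (\<lambda>v. h' (a + t *\<^sub>R (y - a)) (t *\<^sub>R v))) (at y)" .
      from has_derivative_mult_right[OF this, of "t ^ m"]
      have "((\<lambda>y. t ^ m * h (a + t *\<^sub>R (y - a))) has_derivative f' y t) (at y)"
        using linear_cmul[OF has_derivative_linear[OF h'(1)[OF seg[OF yt]]]]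
        by (simp add: f'[OF yt] mult.assoc mult.left_commute)
      then show "((\<lambda>y. t ^ m * h (a + t *\<^sub>R (y - a))) has_derivative f' y t) (at y within C)"
        by (rule has_derivative_at_withinI)
    qed (use cont_f' in \<open>auto simp: case_prod_beta\<close>)
    moreover have "blinfun_apply (integral (cbox 0 1) (f' x)) =
        (\<lambda>v. integral (cbox 0 1) (\<lambda>t. t ^ Suc m * h' (a + t *\<^sub>R (x - a)) v))"
    proof
      fix v
      have "continuous_on (cbox 0 1) (f' x)"
        using continuous_on_compose2[OF cont_f', of "cbox 0 1" "\<lambda>t. (x, t)"] x
          continuous_on_Pair[OF continuous_on_const continuous_on_id, of "{0..1}" x]
        by auto
      then have int: "f' x integrable_on cbox 0 1" by (rule integrable_continuous)
      have "blinfun_apply (integral (cbox 0 1) (f' x)) v = integral (cbox 0 1) (\<lambda>t. blinfun_apply (f' x t) v)"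
        using integral_linear[OF int blinfun.bounded_linear_left[of v]] by (simp add: o_def)
      also have "\<dots> = integral (cbox 0 1) (\<lambda>t. t ^ Suc m * h' (a + t *\<^sub>R (x - a)) v)"
        by (rule integral_cong) (simp add: f'[OF x])
      finally show "blinfun_apply (integral (cbox 0 1) (f' x)) v =
        integral (cbox 0 1) (\<lambda>t. t ^ Suc m * h' (a + t *\<^sub>R (x - a)) v)" .
    qed
    ultimately show ?thesis by (simp only: at_within_open[OF x assms(1)])
  qed
  show ?case
    by (rule Ck_on_SucI[OF assms(1) der Suc.IH[OF h'(2)]])
qed

text \<open>The coefficients are the averages of the partial derivatives over the segment from \<open>a\<close> to \<open>x\<close>;
  the fundamental theorem of calculus along the segment gives the expansion.\<close>

lemma Hadamard:
  fixes h :: "'a::euclidean_space \<Rightarrow> real"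
  assumes "open C" "convex C" "a \<in> C" "smooth_on C h"
  obtains g where "\<And>b. smooth_on C (g b)" "\<And>b. g b a = frechet_derivative h (at a) b"
    "\<And>x. x \<in> C \<Longrightarrow> h x = h a + (\<Sum>b\<in>Basis. ((x - a) \<bullet> b) * g b x)"
proof
  define g where "g b x = integral (cbox 0 1) (\<lambda>t. frechet_derivative h (at (a + t *\<^sub>R (x - a))) b)" for b x
  have g0: "g b = (\<lambda>x. integral (cbox 0 1) (\<lambda>t. t ^ 0 * frechet_derivative h (at (a + t *\<^sub>R (x - a))) b))" for b
    by (rule ext) (simp add: g_def)
  show "smooth_on C (g b)" for b
    unfolding smooth_on_def g0
    using smooth_on_frechet_derivative[OF assms(1,4), of b]
    by (intro allI Ck_on_integral_segment assms) (simp add: smooth_on_def)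
  show "g b a = frechet_derivative h (at a) b" for b
    by (simp add: g_def)
  fix x assume x: "x \<in> C"
  have seg: "a + t *\<^sub>R (x - a) \<in> C" if "t \<in> cbox 0 1" for t
    using convexD_alt[OF assms(2,3) x, of t] that by (simp add: algebra_simps)
  let ?h' = "\<lambda>t. frechet_derivative h (at (a + t *\<^sub>R (x - a)))"
  have lin: "linear (?h' t)" if "t \<in> cbox 0 1" for t
    using smooth_on_has_derivative[OF assms(1,4) seg[OF that]] by (rule has_derivative_linear)
  have expand: "?h' t (x - a) = (\<Sum>b\<in>Basis. ((x - a) \<bullet> b) * ?h' t b)" if "t \<in> cbox 0 1" for t
  proof -
    interpret linear "?h' t" using lin[OF that] .
    have "?h' t (x - a) = ?h' t (\<Sum>b\<in>Basis. ((x - a) \<bullet> b) *\<^sub>R b)"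
      by (simp only: euclidean_representation)
    also have "\<dots> = (\<Sum>b\<in>Basis. ((x - a) \<bullet> b) *\<^sub>R ?h' t b)" by (simp only: sum scale)
    finally show ?thesis by simp
  qed
  have "((\<lambda>t. ?h' t (x - a)) has_integral h (a + 1 *\<^sub>R (x - a)) - h (a + 0 *\<^sub>R (x - a))) {0..1}"
  proof (rule fundamental_theorem_of_calculus)
    fix t :: real assume "t \<in> {0..1}"
    then have t: "t \<in> cbox 0 1" by simp
    have "((\<lambda>t. a + t *\<^sub>R (x - a)) has_derivative (\<lambda>r. r *\<^sub>R (x - a))) (at t)"
      by (auto intro!: derivative_eq_intros)
    from has_derivative_compose[OF this smooth_on_has_derivative[OF assms(1,4) seg[OF t]]]
    have "((\<lambda>t. h (a + t *\<^sub>R (x - a))) has_vector_derivative ?h' t (x - a)) (at t)"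
      using linear_cmul[OF lin[OF t]] by (simp add: has_vector_derivative_def)
    then show "((\<lambda>t. h (a + t *\<^sub>R (x - a))) has_vector_derivative ?h' t (x - a)) (at t within {0..1})"
      by (rule has_vector_derivative_at_within)
  qed simp
  then have "h x - h a = integral (cbox 0 1) (\<lambda>t. ?h' t (x - a))" by (simp add: integral_unique)
  also have "\<dots> = integral (cbox 0 1) (\<lambda>t. \<Sum>b\<in>Basis. ((x - a) \<bullet> b) * ?h' t b)"
    by (rule integral_cong) (rule expand)
  also have "\<dots> = (\<Sum>b\<in>Basis. integral (cbox 0 1) (\<lambda>t. ((x - a) \<bullet> b) * ?h' t b))"
  proof (rule integral_sum)
    fix b :: 'a assume "b \<in> Basis"
    show "(\<lambda>t. ((x - a) \<bullet> b) * ?h' t b) integrable_on cbox 0 1"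
      by (intro integrable_continuous continuous_intros continuous_on_compose2[OF
            smooth_on_imp_continuous_on[OF smooth_on_frechet_derivative[OF assms(1,4)]]])
        (use seg in auto)
  qed simp
  also have "\<dots> = (\<Sum>b\<in>Basis. ((x - a) \<bullet> b) * g b x)" by (simp add: g_def)
  finally show "h x = h a + (\<Sum>b\<in>Basis. ((x - a) \<bullet> b) * g b x)" by simp
qed

section \<open>Functions and tangent vectors in charts\<close>
locale smooth_manifold =
  fixes A :: "('g::{t2_space, second_countable_topology}, 'e::euclidean_space) chart set"
  assumes atlas: "smooth_atlas A"
begin

lemma chart_open: "(U, \<phi>) \<in> A \<Longrightarrow> open U"
  and chart_open_range: "(U, \<phi>) \<in> A \<Longrightarrow> open (\<phi> ` U)"
  using atlas unfolding smooth_atlas_def by auto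

lemma chart_homeomorphism:
  assumes "(U, \<phi>) \<in> A"
  shows "homeomorphism U (\<phi> ` U) \<phi> (inv_into U \<phi>)"
proof -
  obtain \<psi> where \<psi>: "homeomorphism U (\<phi> ` U) \<phi> \<psi>"
    using atlas assms unfolding smooth_atlas_def by blast
  have inj: "inj_on \<phi> U" using homeomorphism_apply1[OF \<psi>] by (rule inj_on_inverseI)
  show ?thesis
  proof (rule homeomorphism_cong[OF \<psi> refl refl refl])
    fix y assume "y \<in> \<phi> ` U"
    then show "inv_into U \<phi> y = \<psi> y"
      using inj homeomorphism_apply1[OF \<psi>] by auto
  qed
qed

lemma chart_inj: "(U, \<phi>) \<in> A \<Longrightarrow> inj_on \<phi> U"
  by (rule inj_on_inverseI[of U "inv_into U \<phi>"])
    (use homeomorphism_apply1[OF chart_homeomorphism] in blast)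

lemma chart_inv [simp]: "(U, \<phi>) \<in> A \<Longrightarrow> x \<in> U \<Longrightarrow> inv_into U \<phi> (\<phi> x) = x"
  using chart_inj by simp

lemma chart_continuous: "(U, \<phi>) \<in> A \<Longrightarrow> continuous_on U \<phi>"
  using chart_homeomorphism homeomorphism_cont1 by blast

lemma chart_open_image:
  assumes "(U, \<phi>) \<in> A" "open W"
  shows "open (\<phi> ` (U \<inter> W))"
proof -
  have "openin (top_of_set (\<phi> ` U)) (\<phi> ` (U \<inter> W))"
    using homeomorphism_imp_open_map[OF chart_homeomorphism[OF assms(1)]] assms(2) by blast
  then show ?thesis using chart_open_range[OF assms(1)] openin_open_trans by blast
qed

lemma chart_open_preimage:
  assumes "(U, \<phi>) \<in> A" "open Q"
  shows "open (U \<inter> \<phi> -` Q)"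
  using continuous_open_preimage[OF chart_continuous chart_open] assms by blast

lemma chart_cover: obtains U \<phi> where "(U, \<phi>) \<in> A" "p \<in> U"
  using atlas unfolding smooth_atlas_def by blast

lemma chart_transition:
  "(U, \<phi>) \<in> A \<Longrightarrow> (V, \<psi>) \<in> A \<Longrightarrow> smooth_on (\<phi> ` (U \<inter> V)) (\<psi> \<circ> inv_into U \<phi>)"
  using atlas unfolding smooth_atlas_def by blast

lemma smooth_map_std_iff:
  "smooth_map A std_atlas W f \<longleftrightarrow> continuous_on W f \<and>
     (\<forall>(U, \<phi>)\<in>A. smooth_on (\<phi> ` (U \<inter> W)) (\<lambda>y. f (inv_into U \<phi> y)))"
  by (simp add: smooth_map_def std_atlas_def o_def)

text \<open>Smoothness near a point may be tested in a single chart: the transition maps carry it to all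
  others.\<close>

lemma smooth_near_chartI:
  assumes c: "(U, \<phi>) \<in> A" "p \<in> U" and Q: "open Q" "\<phi> p \<in> Q" "smooth_on Q h"
    and eq: "\<And>x. x \<in> U \<Longrightarrow> \<phi> x \<in> Q \<Longrightarrow> f x = h (\<phi> x)"
  shows "smooth_near A p f"
proof -
  let ?W = "U \<inter> \<phi> -` Q"
  have W: "open ?W" using chart_open_preimage[OF c(1) Q(1)] .
  have "continuous_on ?W (\<lambda>x. h (\<phi> x))"
    by (rule continuous_on_compose2[OF smooth_on_imp_continuous_on[OF Q(3)]
          continuous_on_subset[OF chart_continuous[OF c(1)]]]) auto
  then have "continuous_on ?W f" by (rule continuous_on_eq) (auto simp: eq)
  moreover have "smooth_on (\<psi> ` (V \<inter> ?W)) (\<lambda>y. f (inv_into V \<psi> y))" if V: "(V, \<psi>) \<in> A" for V \<psi>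
  proof -
    have op: "open (\<psi> ` (V \<inter> ?W))" using chart_open_image[OF V W] .
    have "smooth_on (\<psi> ` (V \<inter> ?W)) (\<phi> \<circ> inv_into V \<psi>)"
      by (rule smooth_on_mono[OF chart_transition[OF V c(1)] chart_open_image[OF V chart_open[OF c(1)]] op])
        auto
    then have "smooth_on (\<psi> ` (V \<inter> ?W)) (\<lambda>y. h ((\<phi> \<circ> inv_into V \<psi>) y))"
      by (rule smooth_on_compose[OF op Q(1) _ Q(3)]) (auto simp: V)
    then show ?thesis by (rule smooth_on_cong_open[OF op]) (auto simp: V eq)
  qed
  ultimately have "smooth_map A std_atlas ?W f" unfolding smooth_map_std_iff by blast
  then show ?thesis using W c(2) Q(2) unfolding smooth_near_def by blast
qed

lemma smooth_near_chartE:
  assumes "smooth_near A p f" and c: "(U, \<phi>) \<in> A" "p \<in> U"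
  obtains Q where "open Q" "\<phi> p \<in> Q" "Q \<subseteq> \<phi> ` U" "smooth_on Q (\<lambda>y. f (inv_into U \<phi> y))"
proof -
  obtain W where W: "open W" "p \<in> W" "smooth_map A std_atlas W f"
    using assms(1) unfolding smooth_near_def by blast
  show thesis
  proof (rule that[of "\<phi> ` (U \<inter> W)"])
    show "smooth_on (\<phi> ` (U \<inter> W)) (\<lambda>y. f (inv_into U \<phi> y))"
      using W(3) c(1) unfolding smooth_map_std_iff by blast
  qed (use W c chart_open_image in auto)
qed

lemma smooth_near_imp_continuous_at:
  assumes "smooth_near A p f"
  shows "isCont f p"
  using assms unfolding smooth_near_def smooth_map_def
  by (meson continuous_on_eq_continuous_at)

lemma smooth_near_cong:
  assumes "smooth_near A p f" "open W" "p \<in> W" "\<And>x. x \<in> W \<Longrightarrow> f x = g x"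
  shows "smooth_near A p g"
proof -
  obtain U \<phi> where c: "(U, \<phi>) \<in> A" "p \<in> U" by (rule chart_cover)
  obtain Q where Q: "open Q" "\<phi> p \<in> Q" "Q \<subseteq> \<phi> ` U" "smooth_on Q (\<lambda>y. f (inv_into U \<phi> y))"
    by (rule smooth_near_chartE[OF assms(1) c])
  let ?Q = "Q \<inter> \<phi> ` (U \<inter> W)"
  have op: "open ?Q" using Q(1) chart_open_image[OF c(1) assms(2)] by blast
  show ?thesis
  proof (rule smooth_near_chartI[OF c op])
    show "smooth_on ?Q (\<lambda>y. f (inv_into U \<phi> y))" by (rule smooth_on_mono[OF Q(4,1) op]) auto
    show "g x = f (inv_into U \<phi> (\<phi> x))" if "x \<in> U" "\<phi> x \<in> ?Q" for x
    proof -
      have "x \<in> W" using that chart_inj[OF c(1)] by (auto dest: inj_onD)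
      then show ?thesis using that c(1) assms(4) by simp
    qed
  qed (use Q c assms in auto)
qed

lemma smooth_near_const: "smooth_near A p (\<lambda>x. k)"
proof -
  obtain U \<phi> where c: "(U, \<phi>) \<in> A" "p \<in> U" by (rule chart_cover)
  show ?thesis
    by (rule smooth_near_chartI[OF c open_UNIV, of "\<lambda>_. k"]) (auto intro: smooth_on_const)
qed

lemma smooth_near_binop:
  assumes "smooth_near A p f" "smooth_near A p g"
    and op: "\<And>S (u :: 'e \<Rightarrow> real) v. open S \<Longrightarrow> smooth_on S u \<Longrightarrow> smooth_on S v \<Longrightarrow> smooth_on S (\<lambda>x. F (u x) (v x))"
  shows "smooth_near A p (\<lambda>x. F (f x) (g x))"
proof -
  obtain U \<phi> where c: "(U, \<phi>) \<in> A" "p \<in> U" by (rule chart_cover)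
  obtain Q where Q: "open Q" "\<phi> p \<in> Q" "Q \<subseteq> \<phi> ` U" "smooth_on Q (\<lambda>y. f (inv_into U \<phi> y))"
    by (rule smooth_near_chartE[OF assms(1) c])
  obtain R where R: "open R" "\<phi> p \<in> R" "R \<subseteq> \<phi> ` U" "smooth_on R (\<lambda>y. g (inv_into U \<phi> y))"
    by (rule smooth_near_chartE[OF assms(2) c])
  have QR: "open (Q \<inter> R)" using Q R by blast
  show ?thesis
  proof (rule smooth_near_chartI[OF c QR])
    show "smooth_on (Q \<inter> R) (\<lambda>y. F (f (inv_into U \<phi> y)) (g (inv_into U \<phi> y)))"
      by (intro op QR smooth_on_mono[OF Q(4,1) QR] smooth_on_mono[OF R(4,1) QR]) auto
  qed (use Q R c in auto)
qed

lemma smooth_near_add: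
  "smooth_near A p f \<Longrightarrow> smooth_near A p g \<Longrightarrow> smooth_near A p (\<lambda>x. f x + g x)"
  by (rule smooth_near_binop[where F = "(+)"]) (auto intro: smooth_on_add)

lemma smooth_near_mult:
  "smooth_near A p f \<Longrightarrow> smooth_near A p g \<Longrightarrow> smooth_near A p (\<lambda>x. f x * g x)"
  by (rule smooth_near_binop[where F = "(*)"]) (auto intro: smooth_on_mult)

lemma smooth_near_sum:
  "(\<And>i. i \<in> J \<Longrightarrow> smooth_near A p (f i)) \<Longrightarrow> smooth_near A p (\<lambda>x. \<Sum>i\<in>J. f i x)"
  by (induction J rule: infinite_finite_induct) (auto intro: smooth_near_const smooth_near_add)

lemma smooth_near_coordinate:
  assumes "(U, \<phi>) \<in> A" "p \<in> U"
  shows "smooth_near A p (\<lambda>x. \<phi> x \<bullet> b)"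
  by (rule smooth_near_chartI[OF assms open_UNIV, of "\<lambda>y. y \<bullet> b"])
    (auto intro: smooth_on_bounded_linear bounded_linear_inner_left)

text \<open>Smoothness is a pointwise local property, so only \<^const>\<open>smooth_near\<close> has to be handled from
  here on.\<close>

lemma smooth_map_iff_smooth_near:
  assumes "open W"
  shows "smooth_map A std_atlas W f \<longleftrightarrow> (\<forall>p\<in>W. smooth_near A p f)"
proof
  assume "smooth_map A std_atlas W f"
  then show "\<forall>p\<in>W. smooth_near A p f" using assms unfolding smooth_near_def by blast
next
  assume near: "\<forall>p\<in>W. smooth_near A p f"
  have "continuous_on W f"
    using near smooth_near_imp_continuous_at by (simp add: continuous_at_imp_continuous_on)
  moreover have "smooth_on (\<phi> ` (U \<inter> W)) (\<lambda>y. f (inv_into U \<phi> y))" if c: "(U, \<phi>) \<in> A" for U \<phi>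
  proof (rule smooth_on_local)
    show op: "open (\<phi> ` (U \<inter> W))" using chart_open_image[OF c assms] .
    fix y assume "y \<in> \<phi> ` (U \<inter> W)"
    then obtain p where p: "p \<in> U" "p \<in> W" "y = \<phi> p" by blast
    obtain Q where Q: "open Q" "\<phi> p \<in> Q" "Q \<subseteq> \<phi> ` U" "smooth_on Q (\<lambda>y. f (inv_into U \<phi> y))"
      using smooth_near_chartE[OF _ c p(1)] near p(2) by blast
    have "open (Q \<inter> \<phi> ` (U \<inter> W))" using op Q(1) by blast
    moreover from this have "smooth_on (Q \<inter> \<phi> ` (U \<inter> W)) (\<lambda>y. f (inv_into U \<phi> y))"
      by (rule smooth_on_mono[OF Q(4,1)]) auto
    ultimately show "\<exists>T. open T \<and> y \<in> T \<and> T \<subseteq> \<phi> ` (U \<inter> W) \<and> smooth_on T (\<lambda>y. f (inv_into U \<phi> y))"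
      using p Q(2) by (intro exI[of _ "Q \<inter> \<phi> ` (U \<inter> W)"]) auto
  qed
  ultimately show "smooth_map A std_atlas W f" unfolding smooth_map_std_iff by blast
qed

lemma tangent_scale: "v \<in> tangent_space A p \<Longrightarrow> smooth_near A p f \<Longrightarrow> v (\<lambda>x. c * f x) = c * v f"
  and tangent_add: "v \<in> tangent_space A p \<Longrightarrow> smooth_near A p f \<Longrightarrow> smooth_near A p g \<Longrightarrow>
    v (\<lambda>x. f x + g x) = v f + v g"
  and tangent_mult: "v \<in> tangent_space A p \<Longrightarrow> smooth_near A p f \<Longrightarrow> smooth_near A p g \<Longrightarrow>
    v (\<lambda>x. f x * g x) = f p * v g + g p * v f"
  and tangent_not_smooth: "v \<in> tangent_space A p \<Longrightarrow> \<not> smooth_near A p f \<Longrightarrow> v f = 0"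
  unfolding tangent_space_def by blast+

lemma tangent_const:
  assumes "v \<in> tangent_space A p"
  shows "v (\<lambda>x. k) = 0"
proof -
  have "v (\<lambda>x. 1 * 1) = 1 * v (\<lambda>x. 1) + 1 * v (\<lambda>x. 1)"
    using tangent_mult[OF assms smooth_near_const smooth_near_const] .
  then have "v (\<lambda>x. 1) = 0" by simp
  then show ?thesis using tangent_scale[OF assms smooth_near_const, of k 1] by simp
qed

lemma tangent_sum:
  assumes "v \<in> tangent_space A p" "\<And>i. i \<in> J \<Longrightarrow> smooth_near A p (f i)"
  shows "v (\<lambda>x. \<Sum>i\<in>J. f i x) = (\<Sum>i\<in>J. v (f i))"
  using assms(2)
proof (induction J rule: infinite_finite_induct)
  case (insert i J)
  have "v (\<lambda>x. f i x + (\<Sum>j\<in>J. f j x)) = v (f i) + v (\<lambda>x. \<Sum>j\<in>J. f j x)"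
    by (rule tangent_add[OF assms(1)]) (auto intro: insert.prems smooth_near_sum)
  then show ?case using insert by simp
qed (simp_all add: tangent_const[OF assms(1)])

text \<open>A function is smooth near \<open>p\<close> as soon as it agrees with a smooth function on some neighbourhood of
  \<open>p\<close>, whatever it does elsewhere. Hence the indicator function of an open neighbourhood can play the
  part of a bump function: it is idempotent, so a derivation annihilates it, and multiplying by it
  does not change the value of a derivation.\<close>

lemma tangent_local:
  assumes v: "v \<in> tangent_space A p" and f: "smooth_near A p f"
    and W: "open W" "p \<in> W" "\<And>x. x \<in> W \<Longrightarrow> f x = g x"
  shows "v f = v g"
proof -
  define u :: "'g \<Rightarrow> real" where "u x = (if x \<in> W then 1 else 0)" for x
  have g: "smooth_near A p g" using smooth_near_cong[OF f W] .
  have u: "smooth_near A p u"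
    by (rule smooth_near_cong[OF smooth_near_const[of p 1] W(1,2)]) (simp add: u_def)
  have "v (\<lambda>x. u x * u x) = u p * v u + u p * v u" using tangent_mult[OF v u u] .
  moreover have "(\<lambda>x. u x * u x) = u" by (auto simp: u_def)
  moreover have up: "u p = 1" using W(2) by (simp add: u_def)
  ultimately have u0: "v u = 0" by simp
  have "v f = v (\<lambda>x. u x * f x)" using tangent_mult[OF v u f] u0 up by simp
  also have "(\<lambda>x. u x * f x) = (\<lambda>x. u x * g x)" using W(3) by (auto simp: u_def)
  also have "v \<dots> = v g" using tangent_mult[OF v u g] u0 up by simp
  finally show ?thesis .
qed

definition tangent_coords :: "('g \<Rightarrow> 'e) \<Rightarrow> 'g tvec \<Rightarrow> 'e" where
  "tangent_coords \<phi> v = (\<Sum>b\<in>Basis. v (\<lambda>x. \<phi> x \<bullet> b) *\<^sub>R b)"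

text \<open>A derivation is a directional derivative in any chart. By Hadamard's lemma
  \<open>f = f(p) + \<Sum>\<^sub>b (\<phi>\<^sub>b - \<phi>\<^sub>b(p)) g\<^sub>b\<close> near \<open>p\<close> with smooth \<open>g\<^sub>b\<close>, and the product rule leaves only
  \<open>\<Sum>\<^sub>b g\<^sub>b(p) v(\<phi>\<^sub>b)\<close>, where \<open>g\<^sub>b(p)\<close> is the partial derivative of \<open>f\<close>. This is what makes an abstractly
  given derivation depend smoothly on parameters in the function it is applied to.\<close>

lemma tangent_eq_frechet_derivative:
  assumes v: "v \<in> tangent_space A p" and c: "(U, \<phi>) \<in> A" "p \<in> U"
    and Q: "open Q" "\<phi> p \<in> Q" "smooth_on Q h"
    and eq: "\<And>x. x \<in> U \<Longrightarrow> \<phi> x \<in> Q \<Longrightarrow> f x = h (\<phi> x)"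
  shows "v f = frechet_derivative h (at (\<phi> p)) (tangent_coords \<phi> v)"
proof -
  obtain r where r: "r > 0" "ball (\<phi> p) r \<subseteq> Q" using Q(1,2) openE by blast
  let ?C = "ball (\<phi> p) r"
  have hC: "smooth_on ?C h" by (rule smooth_on_mono[OF Q(3,1) open_ball r(2)])
  obtain g where g: "\<And>b. smooth_on ?C (g b)" "\<And>b. g b (\<phi> p) = frechet_derivative h (at (\<phi> p)) b"
    "\<And>x. x \<in> ?C \<Longrightarrow> h x = h (\<phi> p) + (\<Sum>b\<in>Basis. ((x - \<phi> p) \<bullet> b) * g b x)"
    using Hadamard[OF open_ball convex_ball _ hC, of "\<phi> p"] r(1) by auto
  let ?W = "U \<inter> \<phi> -` ?C"
  have W: "open ?W" "p \<in> ?W" using chart_open_preimage[OF c(1) open_ball] c(2) r(1) by auto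
  let ?x = "\<lambda>b x. \<phi> x \<bullet> b + - (\<phi> p \<bullet> b)"
  have sx: "smooth_near A p (?x b)" for b
    by (intro smooth_near_add smooth_near_const smooth_near_coordinate[OF c])
  have sg: "smooth_near A p (\<lambda>x. g b (\<phi> x))" for b
    by (rule smooth_near_chartI[OF c open_ball _ g(1)]) (use r(1) in auto)
  have eq': "h (\<phi> p) + (\<Sum>b\<in>Basis. ?x b x * g b (\<phi> x)) = f x" if "x \<in> ?W" for x
  proof -
    have "f x = h (\<phi> x)" using eq that r(2) by auto
    also have "\<dots> = h (\<phi> p) + (\<Sum>b\<in>Basis. ((\<phi> x - \<phi> p) \<bullet> b) * g b (\<phi> x))"
      using that by (intro g(3)) auto
    finally show ?thesis by (simp add: inner_diff_left)
  qed
  have s: "smooth_near A p (\<lambda>x. \<Sum>b\<in>Basis. ?x b x * g b (\<phi> x))"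
    by (intro smooth_near_sum smooth_near_mult sx sg)
  have "v f = v (\<lambda>x. h (\<phi> p) + (\<Sum>b\<in>Basis. ?x b x * g b (\<phi> x)))"
    by (rule tangent_local[OF v _ W eq', symmetric]) (intro smooth_near_add smooth_near_const s)
  also have "\<dots> = v (\<lambda>x. \<Sum>b\<in>Basis. ?x b x * g b (\<phi> x))"
    using tangent_add[OF v smooth_near_const s] tangent_const[OF v] by simp
  also have "\<dots> = (\<Sum>b\<in>Basis. v (\<lambda>x. ?x b x * g b (\<phi> x)))"
    by (rule tangent_sum[OF v]) (intro smooth_near_mult sx sg)
  also have "\<dots> = (\<Sum>b\<in>Basis. v (\<lambda>x. \<phi> x \<bullet> b) * frechet_derivative h (at (\<phi> p)) b)"
  proof (rule sum.cong[OF refl])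
    fix b :: 'e assume "b \<in> Basis"
    have "v (?x b) = v (\<lambda>x. \<phi> x \<bullet> b)"
      using tangent_add[OF v smooth_near_coordinate[OF c] smooth_near_const[of p "- (\<phi> p \<bullet> b)"], of b]
        tangent_const[OF v] by simp
    then show "v (\<lambda>x. ?x b x * g b (\<phi> x)) = v (\<lambda>x. \<phi> x \<bullet> b) * frechet_derivative h (at (\<phi> p)) b"
      using tangent_mult[OF v sx sg] g(2) by simp
  qed
  also have "\<dots> = frechet_derivative h (at (\<phi> p)) (tangent_coords \<phi> v)"
  proof -
    interpret linear "frechet_derivative h (at (\<phi> p))"
      using smooth_on_has_derivative[OF Q(1,3,2)] by (rule has_derivative_linear)
    show ?thesis unfolding tangent_coords_def sum scale by simp
  qed
  finally show ?thesis .
qed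

lemma tangent_eqI:
  assumes "v \<in> tangent_space A p" "w \<in> tangent_space A p" "(U, \<phi>) \<in> A" "p \<in> U"
    "tangent_coords \<phi> v = tangent_coords \<phi> w"
  shows "v = w"
proof
  fix f
  show "v f = w f"
  proof (cases "smooth_near A p f")
    case True
    obtain Q where Q: "open Q" "\<phi> p \<in> Q" "Q \<subseteq> \<phi> ` U" "smooth_on Q (\<lambda>y. f (inv_into U \<phi> y))"
      by (rule smooth_near_chartE[OF True assms(3,4)])
    have eq: "f x = f (inv_into U \<phi> (\<phi> x))" if "x \<in> U" for x using that assms(3) by simp
    show ?thesis
      using tangent_eq_frechet_derivative[OF assms(1,3,4) Q(1,2,4) eq]
        tangent_eq_frechet_derivative[OF assms(2,3,4) Q(1,2,4) eq] assms(5) by simp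
  qed (use assms tangent_not_smooth in metis)
qed

lemma zero_in_tangent_space: "(\<lambda>f. 0) \<in> tangent_space A p"
  by (simp add: tangent_space_def)

lemma tangent_space_lincomb:
  assumes "v \<in> tangent_space A p" "w \<in> tangent_space A p"
  shows "(\<lambda>f. a * v f + b * w f) \<in> tangent_space A p"
  using assms unfolding tangent_space_def by (auto simp: algebra_simps)

lemma tangent_space_sum:
  assumes "\<And>i. i \<in> J \<Longrightarrow> v i \<in> tangent_space A p"
  shows "(\<lambda>f. \<Sum>i\<in>J. a i * v i f) \<in> tangent_space A p"
  using assms
proof (induction J rule: infinite_finite_induct)
  case (insert i J)
  then show ?case
    using tangent_space_lincomb[of "v i" p "\<lambda>f. \<Sum>i\<in>J. a i * v i f" "a i" 1] by simp
qed (simp_all add: zero_in_tangent_space)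

lemma vector_fields_tangent: "X \<in> vector_fields A \<Longrightarrow> X p \<in> tangent_space A p"
  by (simp add: vector_fields_def)

lemma vector_fields_smooth_near:
  assumes "X \<in> vector_fields A" "smooth_near A p f"
  shows "smooth_near A p (\<lambda>q. X q f)"
  using assms unfolding smooth_near_def vector_fields_def by blast

lemma vector_fieldsI:
  assumes "\<And>p. X p \<in> tangent_space A p"
    "\<And>p f. smooth_near A p f \<Longrightarrow> smooth_near A p (\<lambda>q. X q f)"
  shows "X \<in> vector_fields A"
  using assms by (simp add: vector_fields_def smooth_map_iff_smooth_near)

end

section \<open>Left-invariant and right-invariant fields commute\<close>
lemma frechet_derivative_slice:
  fixes F :: "'a::real_normed_vector \<times> 'b::real_normed_vector \<Rightarrow> 'c::real_normed_vector"
  assumes "open S" "smooth_on S F" "(y, z) \<in> S"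
  shows "frechet_derivative (\<lambda>y. F (y, z)) (at y) d = frechet_derivative F (at (y, z)) (d, 0)"
    and "frechet_derivative (\<lambda>z. F (y, z)) (at z) d' = frechet_derivative F (at (y, z)) (0, d')"
proof -
  note F = smooth_on_has_derivative[OF assms]
  have "((\<lambda>y. (y, z)) has_derivative (\<lambda>d. (d, 0))) (at y)"
    by (auto intro!: derivative_eq_intros)
  from frechet_derivative_at[OF has_derivative_compose[OF this F]]
  show "frechet_derivative (\<lambda>y. F (y, z)) (at y) d = frechet_derivative F (at (y, z)) (d, 0)"
    by metis
  have "((\<lambda>z. (y, z)) has_derivative (\<lambda>d. (0, d))) (at z)"
    by (auto intro!: derivative_eq_intros)
  from frechet_derivative_at[OF has_derivative_compose[OF this F]]
  show "frechet_derivative (\<lambda>z. F (y, z)) (at z) d' = frechet_derivative F (at (y, z)) (0, d')"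
    by metis
qed

lemma smooth_on_slice:
  fixes F :: "'a::euclidean_space \<times> 'b::euclidean_space \<Rightarrow> 'c::real_normed_vector"
  assumes "open Q" "open R" "smooth_on (Q \<times> R) F"
  shows "z \<in> R \<Longrightarrow> smooth_on Q (\<lambda>y. F (y, z))"
    and "y \<in> Q \<Longrightarrow> smooth_on R (\<lambda>z. F (y, z))"
proof -
  have QR: "open (Q \<times> R)" using assms by (simp add: open_Times)
  show "smooth_on Q (\<lambda>y. F (y, z))" if "z \<in> R"
    by (rule smooth_on_compose[OF assms(1) QR smooth_on_Pair_const(1)[OF assms(1)] assms(3)])
      (use that in auto)
  show "smooth_on R (\<lambda>z. F (y, z))" if "y \<in> Q"
    by (rule smooth_on_compose[OF assms(2) QR smooth_on_Pair_const(2)[OF assms(2)] assms(3)])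
      (use that in auto)
qed

locale smooth_lie_group =
  fixes A :: "('g::{t2_space, second_countable_topology}, 'e::euclidean_space) chart set"
    and mul :: "'g \<Rightarrow> 'g \<Rightarrow> 'g" and e :: 'g and iv :: "'g \<Rightarrow> 'g"
  assumes lie_group: "lie_group A mul e iv"

sublocale smooth_lie_group \<subseteq> smooth_manifold A
  using lie_group by unfold_locales (simp add: lie_group_def)

sublocale smooth_lie_group \<subseteq> group mul e iv
  using lie_group by (simp add: lie_group_def)

context smooth_lie_group
begin

text \<open>In charts, \<open>f\<close> of a product is a smooth function of two Euclidean variables on a product of open
  sets, so that either variable can be frozen.\<close>

lemma mul_chart_representation:
  assumes c: "(U, \<phi>) \<in> A" "a \<in> U" and d: "(V, \<psi>) \<in> A" "b \<in> V"
    and f: "smooth_near A (mul a b) f"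
  obtains Q R where "open Q" "\<phi> a \<in> Q" "open R" "\<psi> b \<in> R"
    "smooth_on (Q \<times> R) (\<lambda>z. f (mul (inv_into U \<phi> (fst z)) (inv_into V \<psi> (snd z))))"
proof -
  obtain W \<xi> where w: "(W, \<xi>) \<in> A" "mul a b \<in> W" by (rule chart_cover)
  obtain K where K: "open K" "\<xi> (mul a b) \<in> K" "K \<subseteq> \<xi> ` W" "smooth_on K (\<lambda>y. f (inv_into W \<xi> y))"
    by (rule smooth_near_chartE[OF f w])
  let ?m = "\<lambda>(x, y). mul x y"
  have m: "smooth_map (prod_atlas A A) A UNIV ?m" using lie_group by (simp add: lie_group_def)
  have cont: "continuous_on UNIV ?m" using m by (simp add: smooth_map_def)
  define P where "P = (U \<times> V) \<inter> ?m -` W"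
  define S where "S = map_prod \<phi> \<psi> ` P"
  have P: "open P" unfolding P_def
    using open_vimage[OF chart_open[OF w(1)] cont] chart_open[OF c(1)] chart_open[OF d(1)]
    by (simp add: open_Times open_Int)
  have S: "open S"
  proof (rule open_prod_intro)
    fix s assume "s \<in> S"
    then obtain x y where xy: "(x, y) \<in> P" "s = (\<phi> x, \<psi> y)" by (auto simp: S_def)
    obtain G H where GH: "open G" "open H" "(x, y) \<in> G \<times> H" "G \<times> H \<subseteq> P"
      using open_prod_elim[OF P xy(1)] by blast
    have "x \<in> U" "y \<in> V" using xy by (auto simp: P_def)
    moreover have "\<phi> ` (U \<inter> G) \<times> \<psi> ` (V \<inter> H) \<subseteq> S" using GH(4) by (auto simp: S_def)
    ultimately show "\<exists>A B. open A \<and> open B \<and> s \<in> A \<times> B \<and> A \<times> B \<subseteq> S"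
      using chart_open_image[OF c(1) GH(1)] chart_open_image[OF d(1) GH(2)] GH(3) xy(2)
      by (intro exI[of _ "\<phi> ` (U \<inter> G)"] exI[of _ "\<psi> ` (V \<inter> H)"]) auto
  qed
  have inj: "inj_on (map_prod \<phi> \<psi>) (U \<times> V)"
    using chart_inj[OF c(1)] chart_inj[OF d(1)] by (rule map_prod_inj_on)
  have inv: "inv_into (U \<times> V) (map_prod \<phi> \<psi>) (\<phi> x, \<psi> y) = (x, y)" if "x \<in> U" "y \<in> V" for x y
    using inv_into_f_f[OF inj, of "(x, y)"] that by simp
  let ?M = "\<lambda>z. \<xi> (mul (inv_into U \<phi> (fst z)) (inv_into V \<psi> (snd z)))"
  have "(U \<times> V, map_prod \<phi> \<psi>) \<in> prod_atlas A A" using c(1) d(1) by (auto simp: prod_atlas_def)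
  then have "smooth_on S (\<xi> \<circ> ?m \<circ> inv_into (U \<times> V) (map_prod \<phi> \<psi>))"
    using m w(1) unfolding smooth_map_def S_def P_def by fastforce
  then have M: "smooth_on S ?M"
    by (rule smooth_on_cong_open[OF S]) (use c d inv in \<open>auto simp: S_def P_def\<close>)
  define N where "N = S \<inter> ?M -` K"
  have N: "open N"
    unfolding N_def by (rule continuous_open_preimage[OF smooth_on_imp_continuous_on[OF M] S K(1)])
  have abN: "(\<phi> a, \<psi> b) \<in> N"
    unfolding N_def S_def P_def using c d w K by force
  have "smooth_on N ?M" by (rule smooth_on_mono[OF M S N]) (simp add: N_def)
  then have "smooth_on N (\<lambda>z. f (inv_into W \<xi> (?M z)))"
    by (rule smooth_on_compose[OF N K(1) _ K(4)]) (simp add: N_def)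
  then have sN: "smooth_on N (\<lambda>z. f (mul (inv_into U \<phi> (fst z)) (inv_into V \<psi> (snd z))))"
    by (rule smooth_on_cong_open[OF N]) (use c d w in \<open>auto simp: N_def S_def P_def\<close>)
  obtain Q R where QR: "open Q" "open R" "(\<phi> a, \<psi> b) \<in> Q \<times> R" "Q \<times> R \<subseteq> N"
    using open_prod_elim[OF N abN] by blast
  show thesis
    by (rule that[of Q R])
      (use QR smooth_on_mono[OF sN N _ QR(4)] in \<open>auto simp: open_Times\<close>)
qed

lemma smooth_near_right_translation:
  assumes "smooth_near A (mul a b) f"
  shows "smooth_near A a (\<lambda>x. f (mul x b))"
proof -
  obtain U \<phi> where c: "(U, \<phi>) \<in> A" "a \<in> U" by (rule chart_cover)
  obtain V \<psi> where d: "(V, \<psi>) \<in> A" "b \<in> V" by (rule chart_cover)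
  obtain Q R where QR: "open Q" "\<phi> a \<in> Q" "open R" "\<psi> b \<in> R"
    "smooth_on (Q \<times> R) (\<lambda>z. f (mul (inv_into U \<phi> (fst z)) (inv_into V \<psi> (snd z))))"
    by (rule mul_chart_representation[OF c d assms])
  from smooth_on_slice(1)[OF QR(1,3,5,4)]
  show ?thesis by (rule smooth_near_chartI[OF c QR(1,2)]) (simp add: c d)
qed

text \<open>Translating back by the inverse shows that composition with a translation neither gains nor loses
  smoothness; the second half is needed because a tangent vector must vanish on every function that
  is not smooth near its base point.\<close>

lemma push_right_translation_tangent:
  assumes v: "v \<in> tangent_space A a"
  shows "push (\<lambda>x. mul x p) v \<in> tangent_space A (mul a p)"
proof -
  have iff: "smooth_near A (mul a p) f \<longleftrightarrow> smooth_near A a (\<lambda>x. f (mul x p))" for f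
  proof
    assume "smooth_near A a (\<lambda>x. f (mul x p))"
    then have "smooth_near A (mul (mul a p) (iv p)) (\<lambda>x. f (mul x p))" by (simp add: assoc)
    from smooth_near_right_translation[OF this]
    show "smooth_near A (mul a p) f" by (simp add: assoc)
  qed (rule smooth_near_right_translation)
  show ?thesis
    using v unfolding tangent_space_def push_def by (auto simp: iff)
qed

definition right_field :: "'g tvec \<Rightarrow> 'g vfield" where
  "right_field v p = push (\<lambda>x. mul x p) v"

lemma right_field_tangent:
  "v \<in> tangent_space A e \<Longrightarrow> right_field v p \<in> tangent_space A p"
  using push_right_translation_tangent[of v e p] by (simp add: right_field_def group_left_neutral)

text \<open>In charts both sides are mixed second derivatives of \<open>(x, y) \<mapsto> f (x y)\<close>: one factor is
  differentiated along \<open>v\<close>, the other along \<open>w\<close>.\<close>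

lemma mixed_partial_derivatives:
  assumes v: "v \<in> tangent_space A a" and w: "w \<in> tangent_space A b"
    and f: "smooth_near A (mul a b) f"
  shows "smooth_near A b (\<lambda>y. v (\<lambda>x. f (mul x y)))"
    and "w (\<lambda>y. v (\<lambda>x. f (mul x y))) = v (\<lambda>x. w (\<lambda>y. f (mul x y)))"
proof -
  obtain U \<phi> where c: "(U, \<phi>) \<in> A" "a \<in> U" by (rule chart_cover)
  obtain V \<psi> where d: "(V, \<psi>) \<in> A" "b \<in> V" by (rule chart_cover)
  let ?F = "\<lambda>z. f (mul (inv_into U \<phi> (fst z)) (inv_into V \<psi> (snd z)))"
  obtain Q R where QR: "open Q" "\<phi> a \<in> Q" "open R" "\<psi> b \<in> R" "smooth_on (Q \<times> R) ?F"
    by (rule mul_chart_representation[OF c d f])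
  have op: "open (Q \<times> R)" using QR by (simp add: open_Times)
  let ?v = "(tangent_coords \<phi> v, 0)" and ?w = "(0, tangent_coords \<psi> w)"
  define Fv where "Fv z = frechet_derivative ?F (at z) ?v" for z
  define Fw where "Fw z = frechet_derivative ?F (at z) ?w" for z
  have Fv: "smooth_on (Q \<times> R) Fv" unfolding Fv_def by (rule smooth_on_frechet_derivative[OF op QR(5)])
  have Fw: "smooth_on (Q \<times> R) Fw" unfolding Fw_def by (rule smooth_on_frechet_derivative[OF op QR(5)])
  have v_eq: "v (\<lambda>x. f (mul x y)) = Fv (\<phi> a, \<psi> y)" if "y \<in> V" "\<psi> y \<in> R" for y
  proof -
    have "v (\<lambda>x. f (mul x y)) = frechet_derivative (\<lambda>u. ?F (u, \<psi> y)) (at (\<phi> a)) (tangent_coords \<phi> v)"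
      by (rule tangent_eq_frechet_derivative[OF v c QR(1,2) smooth_on_slice(1)[OF QR(1,3,5) that(2)]])
        (simp add: c d that)
    then show ?thesis
      unfolding Fv_def using frechet_derivative_slice(1)[OF op QR(5)] QR(2) that(2) by simp
  qed
  have w_eq: "w (\<lambda>y. f (mul x y)) = Fw (\<phi> x, \<psi> b)" if "x \<in> U" "\<phi> x \<in> Q" for x
  proof -
    have "w (\<lambda>y. f (mul x y)) = frechet_derivative (\<lambda>u. ?F (\<phi> x, u)) (at (\<psi> b)) (tangent_coords \<psi> w)"
      by (rule tangent_eq_frechet_derivative[OF w d QR(3,4) smooth_on_slice(2)[OF QR(1,3,5) that(2)]])
        (simp add: c d that)
    then show ?thesis
      unfolding Fw_def using frechet_derivative_slice(2)[OF op QR(5)] QR(4) that(2) by simp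
  qed
  note sv = smooth_on_slice(2)[OF QR(1,3) Fv QR(2)] and sw = smooth_on_slice(1)[OF QR(1,3) Fw QR(4)]
  show "smooth_near A b (\<lambda>y. v (\<lambda>x. f (mul x y)))"
    by (rule smooth_near_chartI[OF d QR(3,4) sv v_eq])
  have ab: "(\<phi> a, \<psi> b) \<in> Q \<times> R" using QR by simp
  have "w (\<lambda>y. v (\<lambda>x. f (mul x y))) = frechet_derivative Fv (at (\<phi> a, \<psi> b)) ?w"
    using tangent_eq_frechet_derivative[OF w d QR(3,4) sv v_eq]
      frechet_derivative_slice(2)[OF op Fv ab] by simp
  also have "\<dots> = frechet_derivative Fw (at (\<phi> a, \<psi> b)) ?v"
    unfolding Fv_def Fw_def by (rule symmetric_second_derivative[OF op QR(5) ab])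
  also have "\<dots> = v (\<lambda>x. w (\<lambda>y. f (mul x y)))"
    using tangent_eq_frechet_derivative[OF v c QR(1,2) sw w_eq]
      frechet_derivative_slice(1)[OF op Fw ab] by simp
  finally show "w (\<lambda>y. v (\<lambda>x. f (mul x y))) = v (\<lambda>x. w (\<lambda>y. f (mul x y)))" .
qed

lemma right_field_vector_field:
  assumes v: "v \<in> tangent_space A e"
  shows "right_field v \<in> vector_fields A"
proof (rule vector_fieldsI)
  show "smooth_near A p (\<lambda>q. right_field v q f)" if "smooth_near A p f" for p f
    using mixed_partial_derivatives(1)[OF v zero_in_tangent_space, of p f] that
    by (simp add: right_field_def push_def group_left_neutral)
qed (rule right_field_tangent[OF v])

text \<open>A left-invariant field differentiates \<open>f (x y)\<close> in \<open>y\<close> and a right-invariant one in \<open>x\<close>, so their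
  bracket is a difference of mixed partial derivatives and vanishes.\<close>

lemma lie_bracket_left_right:
  assumes Z: "Z \<in> lie_algebra A mul" and v: "v \<in> tangent_space A e" and f: "smooth_near A p f"
  shows "Z p (\<lambda>q. right_field v q f) = right_field v p (\<lambda>q. Z q f)"
proof -
  have Zp: "Z p \<in> tangent_space A p"
    using Z vector_fields_tangent by (simp add: lie_algebra_def)
  have "Z (mul x p) f = Z p (\<lambda>y. f (mul x y))" for x
    using Z by (simp add: lie_algebra_def push_def)
  then show ?thesis
    using mixed_partial_derivatives(2)[OF v Zp] f
    by (simp add: right_field_def push_def group_left_neutral)
qed

end

section \<open>The connection of a bi-invariant metric\<close>
lemma orthonormal_expansion_real3:
  fixes u v w x :: "real^3"
  assumes "norm u = 1" "norm v = 1" "norm w = 1" "u \<bullet> v = 0" "v \<bullet> w = 0" "w \<bullet> u = 0"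
  shows "x = (x \<bullet> u) *\<^sub>R u + (x \<bullet> v) *\<^sub>R v + (x \<bullet> w) *\<^sub>R w"
proof -
  have ne: "u \<noteq> v" "v \<noteq> w" "w \<noteq> u" using assms by auto
  have po: "pairwise orthogonal {u, v, w}"
    using assms by (auto simp: pairwise_def orthogonal_def inner_commute)
  have "independent {u, v, w}"
    by (rule pairwise_orthogonal_independent[OF po]) (use assms in auto)
  moreover have "card {u, v, w} = DIM(real^3)" using ne by auto
  ultimately have "x \<in> span {u, v, w}"
    using card_eq_dim[of "{u, v, w}" UNIV] by auto
  then have "(\<Sum>y\<in>{u, v, w}. (x \<bullet> y) *\<^sub>R y) = x"
    using orthonormal_basis_expand[OF po] assms by auto
  then show ?thesis using ne by (simp add: add.assoc)
qed

locale bi_invariant_lie_group = smooth_lie_group A mul e iv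
  for A :: "('g::{t2_space, second_countable_topology}, real^3) chart set" and mul e iv +
  fixes met :: "'g metric" and D :: "'g vfield \<Rightarrow> 'g vfield \<Rightarrow> 'g vfield" and X :: "3 \<Rightarrow> 'g vfield"
  assumes metric: "riemannian_metric A met"
    and bi_invariant: "bi_invariant A mul met"
    and connection: "levi_civita A met D"
    and basis: "orthonormal_basis A mul met X"
begin

lemma met_commute: "v \<in> tangent_space A p \<Longrightarrow> w \<in> tangent_space A p \<Longrightarrow> met p v w = met p w v"
  using metric unfolding riemannian_metric_def by blast

lemma met_lincomb_left:
  "u \<in> tangent_space A p \<Longrightarrow> v \<in> tangent_space A p \<Longrightarrow> w \<in> tangent_space A p \<Longrightarrow>
    met p (\<lambda>f. a * u f + b * v f) w = a * met p u w + b * met p v w"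
  using metric unfolding riemannian_metric_def by blast

lemma met_smooth:
  "Y \<in> vector_fields A \<Longrightarrow> W \<in> vector_fields A \<Longrightarrow> smooth_near A p (\<lambda>q. met q (Y q) (W q))"
  using metric smooth_map_iff_smooth_near[OF open_UNIV] unfolding riemannian_metric_def by blast

lemma met_sum_left:
  assumes "\<And>i. i \<in> J \<Longrightarrow> v i \<in> tangent_space A p" "w \<in> tangent_space A p"
  shows "met p (\<lambda>f. \<Sum>i\<in>J. a i * v i f) w = (\<Sum>i\<in>J. a i * met p (v i) w)"
proof -
  have zero: "met p (\<lambda>f. 0) w = 0"
    using met_lincomb_left[OF assms(2,2,2), of 0 0] by simp
  show ?thesis using assms(1)
  proof (induction J rule: infinite_finite_induct)
    case (insert i J)
    then show ?case
      using met_lincomb_left[of "v i" p "\<lambda>f. \<Sum>i\<in>J. a i * v i f" w "a i" 1]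
        tangent_space_sum[of J v p a] assms(2) by simp
  qed (simp_all add: zero)
qed

lemma met_sum_right:
  assumes "\<And>i. i \<in> J \<Longrightarrow> v i \<in> tangent_space A p" "w \<in> tangent_space A p"
  shows "met p w (\<lambda>f. \<Sum>i\<in>J. a i * v i f) = (\<Sum>i\<in>J. a i * met p w (v i))"
proof -
  have "met p w (\<lambda>f. \<Sum>i\<in>J. a i * v i f) = met p (\<lambda>f. \<Sum>i\<in>J. a i * v i f) w"
    by (rule met_commute[OF assms(2) tangent_space_sum]) (rule assms(1))
  also have "\<dots> = (\<Sum>i\<in>J. a i * met p (v i) w)" by (rule met_sum_left[OF assms])
  finally show ?thesis using met_commute[OF assms(2) assms(1)] by simp
qed

text \<open>Tangent vectors are determined by their three chart coordinates, and three orthonormal ones have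
  linearly independent coordinates; hence these coordinates span.\<close>

lemma tangent_orthonormal_expansion:
  fixes R :: "3 \<Rightarrow> 'g tvec"
  assumes R: "\<And>i. R i \<in> tangent_space A p" "\<And>i j. met p (R i) (R j) = (if i = j then 1 else 0)"
    and v: "v \<in> tangent_space A p"
  shows "v = (\<lambda>f. \<Sum>k\<in>UNIV. met p v (R k) * R k f)"
proof -
  obtain U \<phi> where c: "(U, \<phi>) \<in> A" "p \<in> U" by (rule chart_cover)
  let ?comb = "\<lambda>c. (\<lambda>f. \<Sum>k\<in>UNIV. c $ k * R k f)"
  define L where "L c = tangent_coords \<phi> (?comb c)" for c :: "real^3"
  have comb: "?comb c \<in> tangent_space A p" for c :: "real^3"
    by (rule tangent_space_sum) (rule R(1))
  \<comment> \<open>Pairing with \<open>R j\<close> recovers the coefficients, which gives both injectivity and their values.\<close>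
  have met_comb: "met p (?comb c) (R j) = c $ j" for c :: "real^3" and j
    by (subst met_sum_left) (simp_all add: R if_distrib[of "(*) _"] cong: if_cong)
  have lin: "linear L"
    by (rule linearI)
      (simp_all add: L_def tangent_coords_def algebra_simps sum.distrib scaleR_sum_right sum_distrib_left)
  moreover have "inj L"
  proof -
    have "c = 0" if "L c = 0" for c
    proof -
      have "?comb c = (\<lambda>f. 0)"
        by (rule tangent_eqI[OF comb zero_in_tangent_space c]) (use that in \<open>simp add: L_def tangent_coords_def\<close>)
      then have "?comb c = ?comb 0" by simp
      from arg_cong[OF this, of "\<lambda>v. met p v (R j)" for j]
      have "c $ j = 0 $ j" for j unfolding met_comb .
      then show ?thesis by (simp add: vec_eq_iff)
    qed
    then show ?thesis using lin by (simp add: linear_injective_0)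
  qed
  ultimately have "surj L" by (rule linear_injective_imp_surjective) simp_all
  then obtain c where "L c = tangent_coords \<phi> v" by (metis surjD)
  then have vc: "v = ?comb c" using tangent_eqI[OF v comb c(1,2)] by (simp add: L_def)
  then have "met p v (R k) = c $ k" for k using met_comb by simp
  then show ?thesis using vc by simp
qed

lemma lie_algebra_vector_fields: "Z \<in> lie_algebra A mul \<Longrightarrow> Z \<in> vector_fields A"
  by (simp add: lie_algebra_def)

lemma basis_lie_algebra: "X i \<in> lie_algebra A mul"
  and basis_orthonormal: "met p (X i p) (X j p) = (if i = j then 1 else 0)"
  using basis unfolding orthonormal_basis_def by blast+

lemma basis_tangent: "X i p \<in> tangent_space A p"
  using vector_fields_tangent lie_algebra_vector_fields basis_lie_algebra by blast

lemma left_field_lie_algebra: "left_field X u \<in> lie_algebra A mul"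
proof -
  have "left_field X u \<in> vector_fields A"
  proof (rule vector_fieldsI)
    show "left_field X u p \<in> tangent_space A p" for p
      unfolding left_field_def by (rule tangent_space_sum) (rule basis_tangent)
    show "smooth_near A p (\<lambda>q. left_field X u q f)" if "smooth_near A p f" for p f
      unfolding left_field_def
      by (intro smooth_near_sum smooth_near_mult smooth_near_const
          vector_fields_smooth_near[OF lie_algebra_vector_fields[OF basis_lie_algebra] that])
  qed
  moreover have "left_field X u (mul g p) = push (mul g) (left_field X u p)" for g p
    using basis_lie_algebra by (simp add: left_field_def push_def lie_algebra_def)
  ultimately show ?thesis by (simp add: lie_algebra_def)
qed

lemmas left_field_vector_field = lie_algebra_vector_fields[OF left_field_lie_algebra]
lemmas left_field_tangent = vector_fields_tangent[OF left_field_vector_field]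

lemma met_left_field_right:
  assumes "v \<in> tangent_space A p"
  shows "met p v (left_field X w p) = (\<chi> k. met p v (X k p)) \<bullet> w"
  unfolding left_field_def
  by (subst met_sum_right) (simp_all add: basis_tangent assms inner_vec_def mult.commute)

lemma met_left_field: "met p (left_field X u p) (left_field X v p) = u \<bullet> v"
proof -
  have "met p (left_field X u p) (X k p) = u $ k" for k
    unfolding left_field_def by (subst met_sum_left) (simp_all add: basis_tangent basis_orthonormal if_distrib[of "(*) _"] cong: if_cong)
  then show ?thesis by (simp add: met_left_field_right[OF left_field_tangent])
qed

text \<open>The infinitesimal form of invariance, obtained without flows. The right-invariant fields \<open>R i\<close> that
  extend \<open>X i e\<close> are orthonormal everywhere, by invariance under right translations, and commute with
  \<open>Z\<close>. If \<open>V = \<Sum>\<^sub>i a\<^sub>i R\<^sub>i\<close> then \<open>[Z, V] = \<Sum>\<^sub>i (Z a\<^sub>i) R\<^sub>i\<close>, so the sum in question is the derivative along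
  \<open>Z\<close> of the constant function \<open>\<langle>Y, W\<rangle>\<close>.\<close>

lemma lie_bracket_skew:
  assumes Z: "Z \<in> lie_algebra A mul" and YW: "Y \<in> vector_fields A" "W \<in> vector_fields A"
    and const: "\<And>q. met q (Y q) (W q) = k"
  shows "met p (lie_bracket A Z Y p) (W p) + met p (lie_bracket A Z W p) (Y p) = 0"
proof -
  define R where "R i = right_field (X i e)" for i
  have R: "R i \<in> vector_fields A" for i
    unfolding R_def by (rule right_field_vector_field[OF basis_tangent])
  note Rt = vector_fields_tangent[OF R]
  have Ron: "met q (R i q) (R j q) = (if i = j then 1 else 0)" for i j q
  proof -
    have "met (mul e q) (push (\<lambda>x. mul x q) (X i e)) (push (\<lambda>x. mul x q) (X j e)) = met e (X i e) (X j e)"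
      using bi_invariant basis_tangent unfolding bi_invariant_def by blast
    then show ?thesis
      by (simp add: R_def right_field_def group_left_neutral basis_orthonormal)
  qed
  have Zp: "Z p \<in> tangent_space A p"
    by (rule vector_fields_tangent[OF lie_algebra_vector_fields[OF Z]])
  define a where "a V i q = met q (V q) (R i q)" for V i q
  have a: "smooth_near A q (a V i)" if "V \<in> vector_fields A" for V i q
    using met_smooth[OF that R, of q i] by (simp add: a_def[abs_def])
  have expand: "V q f = (\<Sum>i\<in>UNIV. a V i q * R i q f)" if "V \<in> vector_fields A" for V q f
    using tangent_orthonormal_expansion[OF Rt Ron vector_fields_tangent[OF that], of q]
    unfolding a_def by metis
  have bracket: "lie_bracket A Z V p = (\<lambda>f. \<Sum>i\<in>UNIV. Z p (a V i) * R i p f)"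
    if V: "V \<in> vector_fields A" for V
  proof
    fix f
    show "lie_bracket A Z V p f = (\<Sum>i\<in>UNIV. Z p (a V i) * R i p f)"
    proof (cases "smooth_near A p f")
      case True
      have Rf: "smooth_near A p (\<lambda>q. R i q f)" for i by (rule vector_fields_smooth_near[OF R True])
      have "Z p (\<lambda>q. V q f) = Z p (\<lambda>q. \<Sum>i\<in>UNIV. a V i q * R i q f)"
        by (simp only: expand[OF V])
      also have "\<dots> = (\<Sum>i\<in>UNIV. Z p (\<lambda>q. a V i q * R i q f))"
        by (rule tangent_sum[OF Zp]) (intro smooth_near_mult a V Rf)
      also have "\<dots> = (\<Sum>i\<in>UNIV. a V i p * R i p (\<lambda>q. Z q f) + Z p (a V i) * R i p f)"
        using tangent_mult[OF Zp a[OF V] Rf] lie_bracket_left_right[OF Z basis_tangent True]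
        by (simp add: R_def mult.commute)
      also have "\<dots> = V p (\<lambda>q. Z q f) + (\<Sum>i\<in>UNIV. Z p (a V i) * R i p f)"
        by (simp only: sum.distrib expand[OF V, of p "\<lambda>q. Z q f"])
      finally show ?thesis using True by (simp add: lie_bracket_def)
    next
      case False
      then show ?thesis using tangent_not_smooth[OF Rt False] by (simp add: lie_bracket_def)
    qed
  qed
  have met_a: "met p (\<lambda>f. \<Sum>i\<in>UNIV. c i * R i p f) (V p) = (\<Sum>i\<in>UNIV. c i * a V i p)"
    if V: "V \<in> vector_fields A" for V c
    using met_sum_left[of UNIV "\<lambda>i. R i p" p "V p" c] Rt vector_fields_tangent[OF V]
      met_commute by (simp add: a_def)
  have "k = (\<Sum>i\<in>UNIV. a Y i q * a W i q)" for q
  proof -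
    have "k = met q (\<lambda>f. \<Sum>i\<in>UNIV. a Y i q * R i q f) (W q)"
      using const[of q] expand[OF YW(1), of q] by (metis (no_types, lifting) ext)
    also have "\<dots> = (\<Sum>i\<in>UNIV. a Y i q * met q (R i q) (W q))"
      by (rule met_sum_left[OF Rt vector_fields_tangent[OF YW(2)]])
    also have "\<dots> = (\<Sum>i\<in>UNIV. a Y i q * a W i q)"
      using met_commute[OF Rt vector_fields_tangent[OF YW(2)]] by (simp add: a_def)
    finally show ?thesis .
  qed
  then have "0 = Z p (\<lambda>q. \<Sum>i\<in>UNIV. a Y i q * a W i q)"
    using tangent_const[OF Zp, of k] by (metis (no_types, lifting) ext)
  also have "\<dots> = (\<Sum>i\<in>UNIV. Z p (\<lambda>q. a Y i q * a W i q))"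
    by (rule tangent_sum[OF Zp]) (intro smooth_near_mult a YW)
  also have "\<dots> = (\<Sum>i\<in>UNIV. Z p (a Y i) * a W i p) + (\<Sum>i\<in>UNIV. Z p (a W i) * a Y i p)"
    using tangent_mult[OF Zp a[OF YW(1)] a[OF YW(2)]] by (simp add: sum.distrib mult.commute)
  also have "\<dots> = met p (lie_bracket A Z Y p) (W p) + met p (lie_bracket A Z W p) (Y p)"
    by (simp only: bracket[OF YW(1)] bracket[OF YW(2)] met_a[OF YW(1)] met_a[OF YW(2)])
  finally show ?thesis by simp
qed

text \<open>The trilinear form \<open>\<langle>\<nabla>\<^sub>U V, W\<rangle>\<close> at \<open>p\<close> on left-invariant fields. The next lemmas show that it is totally
  skew; together with the vanishing of the torsion this says that \<open>\<nabla>\<^sub>U V = 1/2 [U, V]\<close>.\<close>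

definition connection_form :: "'g \<Rightarrow> real^3 \<Rightarrow> real^3 \<Rightarrow> real^3 \<Rightarrow> real" where
  "connection_form p u v w = met p (D (left_field X u) (left_field X v) p) (left_field X w p)"

lemma connection_vector_field:
    "Y \<in> vector_fields A \<Longrightarrow> Z \<in> vector_fields A \<Longrightarrow> D Y Z \<in> vector_fields A"
  and torsion_free: "Y \<in> vector_fields A \<Longrightarrow> Z \<in> vector_fields A \<Longrightarrow>
    D Y Z = vf_add (D Z Y) (lie_bracket A Y Z)"
  and metric_compatible: "Y \<in> vector_fields A \<Longrightarrow> Z \<in> vector_fields A \<Longrightarrow> W \<in> vector_fields A \<Longrightarrow>
    Y p (\<lambda>q. met q (Z q) (W q)) = met p (D Y Z p) (W p) + met p (Z p) (D Y W p)"
  using connection unfolding levi_civita_def by blast+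

lemma connection_tangent: "D (left_field X u) (left_field X v) p \<in> tangent_space A p"
  by (intro vector_fields_tangent connection_vector_field left_field_vector_field)

lemma met_lie_bracket:
  "met p (lie_bracket A (left_field X u) (left_field X v) p) (left_field X w p) =
    connection_form p u v w - connection_form p v u w"
proof -
  let ?u = "left_field X u" and ?v = "left_field X v"
  have "D ?u ?v = vf_add (D ?v ?u) (lie_bracket A ?u ?v)"
    using torsion_free[OF left_field_vector_field left_field_vector_field] .
  then have "lie_bracket A ?u ?v p = (\<lambda>f. 1 * D ?u ?v p f + - 1 * D ?v ?u p f)"
    by (simp add: vf_add_def)
  then show ?thesis
    using met_lincomb_left[OF connection_tangent connection_tangent left_field_tangent, where a = 1 and b = "- 1"]
    by (simp add: connection_form_def)
qed

text \<open>Compatibility with the metric, applied to fields whose inner product is constant.\<close>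

lemma connection_form_skew_23: "connection_form p u v w = - connection_form p u w v"
proof -
  have "left_field X u p (\<lambda>q. met q (left_field X v q) (left_field X w q)) =
      met p (D (left_field X u) (left_field X v) p) (left_field X w p) +
      met p (left_field X v p) (D (left_field X u) (left_field X w) p)"
    using metric_compatible[OF left_field_vector_field left_field_vector_field left_field_vector_field] .
  then show ?thesis
    using tangent_const[OF left_field_tangent] met_commute[OF left_field_tangent connection_tangent]
    by (simp add: connection_form_def met_left_field)
qed

text \<open>Writing brackets as differences of covariant derivatives in the invariance identity, and
  cancelling by skewness in the last two arguments, gives skewness in the first and third; the two
  transpositions generate all permutations.\<close>

lemma connection_form_skew_12: "connection_form p u v w = - connection_form p v u w"
proof -
  have skew_13: "connection_form p a b c = - connection_form p c b a" for a b c
  proof -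
    have "(connection_form p b a c - connection_form p a b c) +
        (connection_form p b c a - connection_form p c b a) = 0"
      using lie_bracket_skew[OF left_field_lie_algebra left_field_vector_field left_field_vector_field
          met_left_field, of p b a c]
      by (simp only: met_lie_bracket)
    then show ?thesis using connection_form_skew_23[of p b a c] by linarith
  qed
  show ?thesis
    using connection_form_skew_23[of p u v w] skew_13[of u w v] connection_form_skew_23[of p v w u]
    by linarith
qed

lemma lie_torsion_eq_connection_form:
  "lie_torsion A met X \<gamma> T N B t = connection_form (\<gamma> t) (T t) (N t) (B t)"
  using met_lie_bracket connection_form_skew_12[of "\<gamma> t" "N t" "T t" "B t"]
  by (simp add: lie_torsion_def)

lemma cov_deriv_inner:
  "cov_deriv met D X I \<gamma> T U t \<bullet> w =
    vector_derivative U (at t within I) \<bullet> w + connection_form (\<gamma> t) (T t) (U t) w"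
  using met_left_field_right[OF connection_tangent]
  by (simp add: cov_deriv_def inner_add_left connection_form_def)

section \<open>Frenet frames in coordinates\<close>

lemma frenet_apparatus_frame:
  assumes "frenet_apparatus A met D X I \<gamma> T N B \<kappa> \<tau>" "t \<in> I"
  shows "norm (T t) = 1" "norm (N t) = 1" "norm (B t) = 1"
    "T t \<bullet> N t = 0" "N t \<bullet> B t = 0" "B t \<bullet> T t = 0" "\<kappa> t > 0"
  using assms unfolding frenet_apparatus_def by blast+

text \<open>In left-invariant coordinates the Frenet equations become those of Euclidean space with torsion
  \<open>\<tau> - \<tau>\<^sub>G\<close>: since the connection form is totally skew, its contribution to \<open>\<nabla>\<^sub>T T\<close> vanishes, and its
  contribution to \<open>\<nabla>\<^sub>T B\<close> is \<open>- \<tau>\<^sub>G N\<close>.\<close>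

lemma frenet_frame_derivatives:
  assumes F: "frenet_apparatus A met D X I \<gamma> T N B \<kappa> \<tau>" and t: "t \<in> I"
  shows "vector_derivative T (at t within I) = \<kappa> t *\<^sub>R N t"
    and "vector_derivative B (at t within I) = - (\<tau> t - lie_torsion A met X \<gamma> T N B t) *\<^sub>R N t"
proof -
  let ?c = "connection_form (\<gamma> t)"
  note on = frenet_apparatus_frame(1-6)[OF F t]
  have dT: "cov_deriv met D X I \<gamma> T T t = \<kappa> t *\<^sub>R N t"
    and dB: "cov_deriv met D X I \<gamma> T B t = - \<tau> t *\<^sub>R N t"
    using F t unfolding frenet_apparatus_def by blast+
  have alt: "?c u u w = 0" "?c u v v = 0" for u v w
    using connection_form_skew_12[of "\<gamma> t" u u w] connection_form_skew_23[of "\<gamma> t" u v v] by auto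
  have "vector_derivative T (at t within I) \<bullet> w = (\<kappa> t *\<^sub>R N t) \<bullet> w" for w
    using cov_deriv_inner[of I \<gamma> T T t w] by (simp add: dT alt)
  then show "vector_derivative T (at t within I) = \<kappa> t *\<^sub>R N t"
    using vector_eq_rdot by blast
  have B: "vector_derivative B (at t within I) \<bullet> w = - \<tau> t * (N t \<bullet> w) - ?c (T t) (B t) w" for w
    using cov_deriv_inner[of I \<gamma> T B t w] by (simp add: dB)
  have "?c (T t) (B t) (T t) = 0"
    using connection_form_skew_23[of "\<gamma> t" "T t" "B t" "T t"] by (simp add: alt)
  moreover have "?c (T t) (B t) (N t) = - lie_torsion A met X \<gamma> T N B t"
    using connection_form_skew_23[of "\<gamma> t" "T t" "B t" "N t"]
    by (simp add: lie_torsion_eq_connection_form)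
  ultimately have coords: "vector_derivative B (at t within I) \<bullet> T t = 0"
      "vector_derivative B (at t within I) \<bullet> N t = - (\<tau> t - lie_torsion A met X \<gamma> T N B t)"
      "vector_derivative B (at t within I) \<bullet> B t = 0"
    using on inner_commute[of "N t" "T t"] by (simp_all add: B alt dot_square_norm)
  show "vector_derivative B (at t within I) =
      - (\<tau> t - lie_torsion A met X \<gamma> T N B t) *\<^sub>R N t"
    using orthonormal_expansion_real3[OF on, of "vector_derivative B (at t within I)"]
    unfolding coords by simp
qed

end

section \<open>Conjugate mates\<close>

lemma smooth_on_has_vector_derivative:
  fixes f :: "real \<Rightarrow> 'b::real_normed_vector"
  assumes "smooth_on S f" "t \<in> S"
  shows "(f has_vector_derivative vector_derivative f (at t within S)) (at t within S)"
proof -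
  have "Ck_on (Suc 0) S f" using assms(1) unfolding smooth_on_def by blast
  then show ?thesis using assms(2) by (simp add: vector_derivative_works)
qed

lemma vector_derivative_scaled_cong:
  fixes f g :: "real \<Rightarrow> 'b::real_normed_vector"
  assumes "at t within S \<noteq> bot" "t \<in> S" "\<And>s. s \<in> S \<Longrightarrow> g s = c *\<^sub>R f s"
    and "(f has_vector_derivative f') (at t within S)"
  shows "vector_derivative g (at t within S) = c *\<^sub>R f'"
proof -
  have "((\<lambda>s. c *\<^sub>R f s) has_vector_derivative c *\<^sub>R f') (at t within S)"
    using has_vector_derivative_scaleR[OF DERIV_const assms(4), of c] by simp
  then have "(g has_vector_derivative c *\<^sub>R f') (at t within S)"
    by (rule has_vector_derivative_transform[OF assms(2), rotated]) (simp add: assms(3))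
  then show ?thesis by (rule vector_derivative_within[OF assms(1)])
qed

context bi_invariant_lie_group
begin

text \<open>Differentiating \<open>T\<^sup>* = B\<close> gives \<open>\<kappa>\<^sup>* N\<^sup>* = - (\<tau> - \<tau>\<^sub>G) N\<close>, so \<open>N\<^sup>*\<close> is a nonzero multiple of \<open>N\<close>. Hence
  \<open>B\<^sup>*\<close>, being orthogonal to \<open>B\<close> and \<open>N\<close>, is \<open>\<plusminus>T\<close>, with a sign \<open>\<sigma> = B\<^sup>* \<bullet> T\<close> that is continuous and
  therefore constant on the interval. Differentiating \<open>B\<^sup>* = \<sigma> T\<close> gives
  \<open>- (\<tau>\<^sup>* - \<tau>\<^sub>G\<^sup>*) N\<^sup>* = \<sigma> \<kappa> N\<close>, and comparing the two equations yields \<open>H H\<^sup>* = \<sigma>\<close>.\<close>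

lemma conjugate_mate_harmonic_curvature:
  assumes I: "is_interval I" "interior I \<noteq> {}"
    and F: "frenet_apparatus A met D X I \<gamma> T N B \<kappa> \<tau>"
    and mate: "conjugate_mate A met D X I B \<gamma>s Ts Ns Bs \<kappa>s \<tau>s"
  obtains c where "c \<noteq> 0" "\<And>t. t \<in> I \<Longrightarrow>
    harmonic_curvature A met X \<gamma> T N B \<kappa> \<tau> t *
    harmonic_curvature A met X \<gamma>s Ts Ns Bs \<kappa>s \<tau>s t = c"
proof -
  have Fs: "frenet_apparatus A met D X I \<gamma>s Ts Ns Bs \<kappa>s \<tau>s" and TsB: "\<And>t. t \<in> I \<Longrightarrow> Ts t = B t"
    using mate unfolding conjugate_mate_def by auto
  define h where "h t = \<tau> t - lie_torsion A met X \<gamma> T N B t" for t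
  define hs where "hs t = \<tau>s t - lie_torsion A met X \<gamma>s Ts Ns Bs t" for t
  note frame = frenet_apparatus_frame[OF F]
  have frames: "norm (Bs t) = 1" "Ns t \<bullet> Bs t = 0" "norm (Ns t) = 1" "Bs t \<bullet> B t = 0" "\<kappa>s t > 0"
    if "t \<in> I" for t
    using frenet_apparatus_frame[OF Fs that] TsB[OF that] by auto
  have smooth: "smooth_on I T" "smooth_on I B" "smooth_on I Bs"
    using F Fs unfolding frenet_apparatus_def by blast+
  have conn: "connected I" using I(1) by (rule is_interval_connected)
  \<comment> \<open>Derivatives relative to \<open>I\<close> are unique, at end points too.\<close>
  have nontrivial: "at t within I \<noteq> bot" if "t \<in> I" for t
  proof -
    have "I \<noteq> {x}" for x using I(2) by auto
    then have "t islimpt I" by (rule connected_imp_perfect[OF conn that])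
    then show ?thesis by (simp add: trivial_limit_within)
  qed
  have Ns: "\<kappa>s t *\<^sub>R Ns t = - h t *\<^sub>R N t" if t: "t \<in> I" for t
  proof -
    have "vector_derivative Ts (at t within I) = 1 *\<^sub>R vector_derivative B (at t within I)"
      by (rule vector_derivative_scaled_cong[OF nontrivial[OF t] t _
            smooth_on_has_vector_derivative[OF smooth(2) t]]) (simp add: TsB)
    then show ?thesis
      using frenet_frame_derivatives(1)[OF Fs t] frenet_frame_derivatives(2)[OF F t] by (simp add: h_def)
  qed
  define \<sigma> where "\<sigma> t = Bs t \<bullet> T t" for t
  have Bs: "Bs t = \<sigma> t *\<^sub>R T t" if t: "t \<in> I" for t
  proof -
    have "h t \<noteq> 0" using Ns[OF t] frames[OF t] by auto
    moreover have "h t * (N t \<bullet> Bs t) = 0"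
      using arg_cong[OF Ns[OF t], of "\<lambda>x. x \<bullet> Bs t"] frames(2)[OF t] by simp
    ultimately have "Bs t \<bullet> N t = 0" by (simp add: inner_commute)
    then show ?thesis
      using orthonormal_expansion_real3[OF frame(1-6)[OF t], of "Bs t"] frames(4)[OF t]
      by (simp add: \<sigma>_def)
  qed
  have \<sigma>: "\<sigma> t \<in> {- 1, 1}" if t: "t \<in> I" for t
    using arg_cong[OF Bs[OF t], of norm] frames(1)[OF t] frame(1)[OF t] by auto
  have "\<sigma> constant_on I"
  proof (rule continuous_finite_range_constant[OF conn])
    show "continuous_on I \<sigma>"
      unfolding \<sigma>_def by (intro continuous_intros smooth_on_imp_continuous_on smooth)
    show "finite (\<sigma> ` I)" by (rule finite_subset[of _ "{- 1, 1}"]) (use \<sigma> in auto)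
  qed
  then obtain c where c: "\<And>t. t \<in> I \<Longrightarrow> \<sigma> t = c" unfolding constant_on_def by blast
  have prod: "h t * hs t = c * \<kappa> t * \<kappa>s t" if t: "t \<in> I" for t
  proof -
    have "vector_derivative Bs (at t within I) = c *\<^sub>R (\<kappa> t *\<^sub>R N t)"
      using vector_derivative_scaled_cong[OF nontrivial[OF t] t _
          smooth_on_has_vector_derivative[OF smooth(1) t], of Bs c]
        frenet_frame_derivatives(1)[OF F t] Bs c by simp
    then have Ns': "- hs t *\<^sub>R Ns t = (c * \<kappa> t) *\<^sub>R N t"
      using frenet_frame_derivatives(2)[OF Fs t] by (simp add: hs_def)
    have NN: "N t \<bullet> N t = 1" using frame(2)[OF t] by (simp add: dot_square_norm)
    have 1: "- hs t * (Ns t \<bullet> N t) = c * \<kappa> t"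
      using arg_cong[OF Ns', of "\<lambda>x. x \<bullet> N t"] NN by simp
    have 2: "\<kappa>s t * (Ns t \<bullet> N t) = - h t"
      using arg_cong[OF Ns[OF t], of "\<lambda>x. x \<bullet> N t"] NN by simp
    have "h t * hs t = - (\<kappa>s t * (Ns t \<bullet> N t)) * hs t" unfolding 2 by simp
    also have "\<dots> = \<kappa>s t * (- hs t * (Ns t \<bullet> N t))" by (simp add: algebra_simps)
    finally have "h t * hs t = \<kappa>s t * (- hs t * (Ns t \<bullet> N t))" .
    then show ?thesis unfolding 1 by (simp add: algebra_simps)
  qed
  obtain t0 where "t0 \<in> I" using I(2) interior_subset by blast
  then have "c \<noteq> 0" using \<sigma> c by force
  moreover have "harmonic_curvature A met X \<gamma> T N B \<kappa> \<tau> t *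
    harmonic_curvature A met X \<gamma>s Ts Ns Bs \<kappa>s \<tau>s t = c" if "t \<in> I" for t
    using prod[OF that] frame(7)[OF that] frames(5)[OF that]
    by (simp add: harmonic_curvature_def h_def[symmetric] hs_def[symmetric] field_simps)
  ultimately show thesis by (rule that)
qed

end

lemma constant_iff_of_constant_product:
  fixes f g :: "'a \<Rightarrow> 'b::field"
  assumes "c \<noteq> 0" "\<And>t. t \<in> S \<Longrightarrow> f t * g t = c"
  shows "(\<exists>k. \<forall>t\<in>S. f t = k) \<longleftrightarrow> (\<exists>k. \<forall>t\<in>S. g t = k)"
proof -
  have "f t = c / g t" "g t = c / f t" if "t \<in> S" for t
    using assms(1) assms(2)[OF that] by (auto simp: field_simps)
  then show ?thesis by metis
qed

theorem corollary6p1: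
  fixes A :: "('g::{t2_space, second_countable_topology}, real^3) chart set"
    and mul :: "'g \<Rightarrow> 'g \<Rightarrow> 'g" and e :: 'g and iv :: "'g \<Rightarrow> 'g"
    and met :: "'g metric"
    and D :: "'g vfield \<Rightarrow> 'g vfield \<Rightarrow> 'g vfield"
    and X :: "3 \<Rightarrow> 'g vfield"
    and I :: "real set"
    and \<gamma> \<gamma>s :: "real \<Rightarrow> 'g"
    and T N B Ts Ns Bs :: "real \<Rightarrow> real^3"
    and \<kappa> \<tau> \<kappa>s \<tau>s :: "real \<Rightarrow> real"
  assumes "lie_group A mul e iv"
    and "riemannian_metric A met" and "bi_invariant A mul met"
    and "levi_civita A met D"
    and "orthonormal_basis A mul met X"
    and "is_interval I" and "interior I \<noteq> {}"
    and "frenet_curve A met D X I \<gamma> T N B \<kappa> \<tau>"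
    and "\<forall>t\<in>I. \<tau> t - lie_torsion A met X \<gamma> T N B t \<noteq> 0"
    and "conjugate_mate A met D X I B \<gamma>s Ts Ns Bs \<kappa>s \<tau>s"
  shows "general_helix A met X I \<gamma> T N B \<kappa> \<tau> \<longleftrightarrow>
         general_helix A met X I \<gamma>s Ts Ns Bs \<kappa>s \<tau>s"
proof -
  interpret bi_invariant_lie_group A mul e iv met D X
    using assms(1-5) by unfold_locales
  have F: "frenet_apparatus A met D X I \<gamma> T N B \<kappa> \<tau>"
    using assms(8) unfolding frenet_curve_def by blast
  obtain c where "c \<noteq> 0" "\<And>t. t \<in> I \<Longrightarrow>
    harmonic_curvature A met X \<gamma> T N B \<kappa> \<tau> t *
    harmonic_curvature A met X \<gamma>s Ts Ns Bs \<kappa>s \<tau>s t = c"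
    using conjugate_mate_harmonic_curvature[OF assms(6,7) F assms(10)] by blast
  then show ?thesis
    unfolding general_helix_def by (rule constant_iff_of_constant_product)
qed

end
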